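(* Let $L_+(s)=\sum_{n\ge1}\tau_n^{-s}$ ($\operatorname{Re}s>1$), continued meromorphically to $\mathbb{C}$, where $(\pm\tau_n)_{n\ge1}$ are the zeros of the H\"ormander--Bernhardsson extremal function, and let $C>0$ be the constant in the inversion functional equation for $\Phi$ (see context). Then for every $k\in\mathbb{Z}$, $$L_+(-2k)=\frac{L_+(2k)}{(2\pi iC)^{2k}} .$$
   Context: The H\"ormander--Bernhardsson extremal function $\varphi$ is the unique minimizer of $\int_{\mathbb{R}}|f(x)|\,dx$ among entire functions $f$ of exponential type at most $\pi$ with $f(0)=1$. It is even, its zeros are real and simple, written $\pm\tau_n$ with $0<\tau_1<\tau_2<\cdots\to\infty$, and $\varphi(z)=\prod_{n\ge1}(1-z^2/\tau_n^2)$. Recalled from earlier work (Bondarenko, Ortega-Cerd\`a, Radchenko, Seip): there is an odd power series $\rho$ with nonnegative coefficients, which converges if and only if $|z|\le2$, with $\rho(2)=\tfrac12$, such that $\tau_n=n+\tfrac12-\rho\bigl(\tfrac1{n+1/2}\bigr)$ for all $n\ge1$. Put $\Phi(z)=\prod_{n\ge1}\bigl(1+(-1)^n\frac{z}{\tau_n}\bigr)$, so that $\varphi(z)=\Phi(z)\Phi(-z)$ and $\Phi(0)=1$. The constant $C>0$ is the one (from the same earlier work) for which, with $Tz:=\frac1{2\pi iCz}$, the functional equation $$\Phi(z)\,e^{\frac1{4Cz}}=\frac{e^{-i\pi/4+\frac{i\pi}2z}\,\Phi(Tz)+e^{i\pi/4-\frac{i\pi}2z}\,\Phi(-Tz)}{2\sqrt{\pi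 C}\,z}$$ holds for all $z\in\mathbb{C}\setminus\{0\}$. The function $L_+$ has a meromorphic continuation to $\mathbb{C}$; its values at nonpositive even integers are those of this continuation, which is holomorphic there. *)

theory Defs
  imports "HOL-Complex_Analysis.Complex_Analysis"
begin

definition exponential_type_at_most :: "real \<Rightarrow> (complex \<Rightarrow> complex) \<Rightarrow> bool" where
  "exponential_type_at_most \<sigma> f \<longleftrightarrow>
     (\<forall>\<epsilon>>0. \<exists>A. \<forall>z. norm (f z) \<le> A * exp ((\<sigma> + \<epsilon>) * norm z))"

definition HB_admissible :: "(complex \<Rightarrow> complex) \<Rightarrow> bool" where
  "HB_admissible f \<longleftrightarrow>
     f holomorphic_on UNIV \<and> exponential_type_at_most pi f \<and> f 0 = 1"

text \<open>The integral is taken in the extended nonnegative reals, so that a function that is not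
  integrable on the real line has infinite norm (the Bochner integral would give it norm 0).\<close>
definition L1_norm_real_line :: "(complex \<Rightarrow> complex) \<Rightarrow> ennreal" where
  "L1_norm_real_line f = (\<integral>\<^sup>+ x. ennreal (norm (f (complex_of_real x))) \<partial>lborel)"

text \<open>Strict inequality against every competitor: a minimizer, and the only one.\<close>
definition HB_extremal :: "(complex \<Rightarrow> complex) \<Rightarrow> bool" where
  "HB_extremal \<phi> \<longleftrightarrow> HB_admissible \<phi> \<and>
     (\<forall>f. HB_admissible f \<and> f \<noteq> \<phi> \<longrightarrow> L1_norm_real_line \<phi> < L1_norm_real_line f)"

text \<open>Zeros are numbered from 1; the value \<open>\<tau> 0\<close> is never used. The library's
  infinite product is the limit of the partial products, so conditional convergence is allowed.\<close>
definition HB_Phi :: "(nat \<Rightarrow> real) \<Rightarrow> complex \<Rightarrow> complex" where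
  "HB_Phi \<tau> z = (\<Prod>n. 1 + (-1) ^ Suc n * (z / complex_of_real (\<tau> (Suc n))))"

definition HB_T :: "real \<Rightarrow> complex \<Rightarrow> complex" where
  "HB_T C z = 1 / (2 * complex_of_real pi * \<i> * complex_of_real C * z)"

definition HB_functional_equation :: "(nat \<Rightarrow> real) \<Rightarrow> real \<Rightarrow> bool" where
  "HB_functional_equation \<tau> C \<longleftrightarrow>
     (\<forall>z. z \<noteq> 0 \<longrightarrow>
        HB_Phi \<tau> z * exp (1 / (4 * complex_of_real C * z)) =
          (exp (- (\<i> * pi / 4) + (\<i> * pi / 2) * z) * HB_Phi \<tau> (HB_T C z)
           + exp (\<i> * pi / 4 - (\<i> * pi / 2) * z) * HB_Phi \<tau> (- HB_T C z))
          / (2 * complex_of_real (sqrt (pi * C)) * z))"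

text \<open>The predicate \<open>nicely_meromorphic_on\<close> fixes the values at removable
  singularities (by continuity) and at poles (as 0), so there is at most one such function.\<close>
definition is_L_plus :: "(nat \<Rightarrow> real) \<Rightarrow> (complex \<Rightarrow> complex) \<Rightarrow> bool" where
  "is_L_plus \<tau> L \<longleftrightarrow> L nicely_meromorphic_on UNIV \<and>
     (\<forall>s. Re s > 1 \<longrightarrow> (\<lambda>n. complex_of_real (\<tau> (Suc n)) powr (- s)) sums L s)"

definition L_plus :: "(nat \<Rightarrow> real) \<Rightarrow> complex \<Rightarrow> complex" where
  "L_plus \<tau> = (THE L. is_L_plus \<tau> L)"

end

(* With F(t) = \<Sum> ln (1 + t / \<tau>_n^2), which is ln \<phi>(i \<surd>t), Fubini gives, for 1/2 < b < 1, that the Mellin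
   integral of F(t) t^(-b-1) over (0, \<infinity>) is \<pi> L_+(2b) / (b sin \<pi>b). Multiplying the functional
   equations at \<plusminus>iy makes the mixed terms cancel and leaves, with w = 1/(2\<pi>Cy),
   4\<pi>C y^2 \<phi>(iy) = \<Phi>(w)^2 e^(\<pi>y) + \<Phi>(-w)^2 e^(-\<pi>y). Hence F(t) equals
   \<pi> \<surd>t - ln (4\<pi>C t) + 2 ln \<Phi>(w) up to an exponentially small error, where w = 1/(2\<pi>C \<surd>t) and
   ln \<Phi>(w) is a power series in w whose coefficient of w^(2k) is -L_+(2k)/(2k). Splitting the Mellin
   integral at a large cutoff continues it meromorphically, and its residue at b = -k is the
   coefficient of t^(-k). The simple zero of b sin \<pi>b turns this residue into the value L_+(-2k). *)
theory Submission
  imports Defs "HOL-Real_Asymp.Real_Asymp"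
begin

section \<open>Series of holomorphic functions and Mellin transforms\<close>

text \<open>The Mellin integral lives in a strip: F(t) = O(t) at 0 allows b < 1, while growth like
  pi * sqrt t at infinity asks for b > 1/2. The continuation drawn from it covers Re s < 2 and has
  to be glued to the Dirichlet series, which it meets in 1 < Re s < 2. The zeros enter the estimates
  through n <= \<tau>_n, a consequence of rho(2) = 1/2, and through their order: the bound handles
  all power sums of exponent at least 2, whereas the sum of exponent 1 in ln \<Phi> is out of its
  reach and converges by alternation. Powers of 1 / sqrt t put possible poles at every b = -j/2, but
  sin(pi b) vanishes at integers only; this is why the argument reads off values at even s. The sign
  i^(2k) in the formula is the sign (-1)^k of the slope of sin(pi b) at -k. At b = 0 the term -ln t
  creates a double pole, which meets the double zero of b sin(pi b) and yields the value -1.\<close>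

lemma holomorphic_on_suminf:
  fixes f :: "nat \<Rightarrow> complex \<Rightarrow> complex"
  assumes "open S" and hol: "\<And>n. f n holomorphic_on S"
    and bound: "\<And>n x. x \<in> S \<Longrightarrow> norm (f n x) \<le> M n" and "summable M"
  shows "(\<lambda>x. \<Sum>n. f n x) holomorphic_on S"
proof (rule holomorphic_uniform_sequence[OF \<open>open S\<close>])
  show "(\<lambda>x. \<Sum>i<n. f i x) holomorphic_on S" for n
    by (intro holomorphic_intros hol)
  have unif: "uniform_limit S (\<lambda>n x. \<Sum>i<n. f i x) (\<lambda>x. \<Sum>n. f n x) sequentially"
    using bound \<open>summable M\<close> by (rule Weierstrass_m_test)
  fix x assume "x \<in> S"
  then obtain d where "d > 0" "cball x d \<subseteq> S"
    using \<open>open S\<close> open_contains_cball by blast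
  with unif show "\<exists>d>0. cball x d \<subseteq> S \<and>
      uniform_limit (cball x d) (\<lambda>n x. \<Sum>i<n. f i x) (\<lambda>x. \<Sum>n. f n x) sequentially"
    using uniform_limit_on_subset by blast
qed

section \<open>Mellin transforms and their holomorphy\<close>

text \<open>The kernel is \<open>t powr (- b - 1)\<close>, so this is the usual transform at
  \<open>- b\<close>; written with \<open>exp\<close> it is visibly entire in \<open>b\<close> for
  each \<open>t\<close>. The functions transformed below vanish for
  \<open>t \<le> 0\<close>.\<close>

definition mellin :: "(real \<Rightarrow> real) \<Rightarrow> complex \<Rightarrow> complex" where
  "mellin f b = (LINT t|lborel. f t *\<^sub>R exp (- (b + 1) * of_real (ln t)))"

lemma mellin_of_real:
  "mellin f (of_real b) = of_real (LINT t|lborel. f t * exp (- (b + 1) * ln t))"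
proof -
  have "mellin f (of_real b) = (LINT t|lborel. of_real (f t * exp (- (b + 1) * ln t)))"
    unfolding mellin_def
    by (intro Bochner_Integration.integral_cong) (auto simp: scaleR_conv_of_real exp_of_real [symmetric])
  also have "\<dots> = of_real (LINT t|lborel. f t * exp (- (b + 1) * ln t))"
    by (rule integral_complex_of_real)
  finally show ?thesis .
qed

text \<open>Expanding \<open>t powr (z - w)\<close> into powers of \<open>w - z\<close> and integrating termwise exhibits the
  Mellin transform as a power series.\<close>
lemma mellin_holomorphic_on_ball:
  assumes [measurable]: "f \<in> borel_measurable borel"
    and int1: "integrable lborel (\<lambda>t. f t * exp ((r - (Re z + 1)) * ln t))"
    and int2: "integrable lborel (\<lambda>t. f t * exp ((- r - (Re z + 1)) * ln t))"
  shows "mellin f holomorphic_on ball z r"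
proof (rule power_series_holomorphic)
  fix w assume "w \<in> ball z r"
  define \<delta> where "\<delta> = norm (w - z)"
  have \<delta>: "0 \<le> \<delta>" "\<delta> < r"
    using \<open>w \<in> ball z r\<close> by (auto simp: \<delta>_def dist_norm norm_minus_commute)
  define e where "e = (\<lambda>t::real. f t *\<^sub>R exp (- (z + 1) * of_real (ln t)))"
  define g where "g = (\<lambda>m t. e t * ((- of_real (ln t) * (w - z)) ^ m / fact m))"
  \<comment> \<open>Dominating function: as \<open>\<delta> < r\<close>, the factor
    \<open>exp (\<bar>ln t\<bar> * \<delta>)\<close> is at most
    \<open>exp (r * ln t) + exp (- r * ln t)\<close>, so all expansion terms together are controlled
    by the two assumed integrals.\<close>
  define D where "D = (\<lambda>t. \<bar>f t * exp ((r - (Re z + 1)) * ln t)\<bar> + \<bar>f t * exp ((- r - (Re z + 1)) * ln t)\<bar>)"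
  have [measurable]: "g m \<in> borel_measurable borel" for m
    unfolding g_def e_def by measurable
  have intD: "integrable lborel D"
    unfolding D_def using int1 int2 by (intro Bochner_Integration.integrable_add integrable_abs) auto
  have norm_e: "norm (e t) = \<bar>f t\<bar> * exp (- (Re z + 1) * ln t)" for t
    by (simp add: e_def)
  have norm_g: "norm (g m t) = norm (e t) * ((\<bar>ln t\<bar> * \<delta>) ^ m / fact m)" for m t
    by (simp add: g_def \<delta>_def norm_mult norm_divide norm_power)
  have norm_g_sums: "(\<lambda>m. norm (g m t)) sums (norm (e t) * exp (\<bar>ln t\<bar> * \<delta>))" for t
  proof -
    have "(\<lambda>m. (\<bar>ln t\<bar> * \<delta>) ^ m / fact m) sums exp (\<bar>ln t\<bar> * \<delta>)"
      using exp_converges[of "\<bar>ln t\<bar> * \<delta>"] by (simp add: divide_inverse mult.commute)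
    thus ?thesis unfolding norm_g by (rule sums_mult)
  qed
  have D_bound: "norm (e t) * exp (\<bar>ln t\<bar> * \<delta>) \<le> D t" for t
  proof -
    have "exp (\<bar>ln t\<bar> * \<delta>) \<le> exp (\<bar>ln t\<bar> * r)"
      using \<delta> by (simp add: mult_left_mono)
    also have "\<dots> \<le> exp (r * ln t) + exp (- r * ln t)"
      by (cases "ln t \<ge> 0") (auto simp: mult.commute add_increasing add_increasing2)
    finally have "norm (e t) * exp (\<bar>ln t\<bar> * \<delta>) \<le>
        \<bar>f t\<bar> * exp (- (Re z + 1) * ln t) * (exp (r * ln t) + exp (- r * ln t))"
      unfolding norm_e by (intro mult_left_mono) auto
    also have "\<dots> = D t"
      by (simp add: D_def abs_mult algebra_simps flip: exp_add)
    finally show ?thesis .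
  qed
  have sum_g_le: "(\<Sum>m<N. norm (g m t)) \<le> D t" for N t
  proof -
    have "(\<Sum>m<N. norm (g m t)) \<le> (\<Sum>m. norm (g m t))"
      using norm_g_sums[of t] by (intro sum_le_suminf) (auto simp: sums_iff)
    also have "\<dots> \<le> D t"
      using norm_g_sums[of t] D_bound[of t] by (simp add: sums_iff)
    finally show ?thesis .
  qed
  have int_g: "integrable lborel (g m)" for m
  proof (rule Bochner_Integration.integrable_bound[OF intD])
    have "norm (g m t) \<le> norm (D t)" for t
    proof -
      have "norm (g m t) \<le> (\<Sum>m<Suc m. norm (g m t))"
        by (rule member_le_sum) auto
      also have "\<dots> \<le> D t" by (rule sum_g_le)
      finally show ?thesis by simp
    qed
    thus "AE t in lborel. norm (g m t) \<le> norm (D t)" by simp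
  qed simp
  have summable_int: "summable (\<lambda>m. LINT t|lborel. norm (g m t))"
  proof (rule summableI_nonneg_bounded)
    fix N
    have "(\<Sum>m<N. LINT t|lborel. norm (g m t)) = (LINT t|lborel. (\<Sum>m<N. norm (g m t)))"
      using int_g by simp
    also have "\<dots> \<le> (LINT t|lborel. D t)"
      using int_g intD sum_g_le by (intro integral_mono) auto
    finally show "(\<Sum>m<N. LINT t|lborel. norm (g m t)) \<le> (LINT t|lborel. D t)" .
  qed auto
  have AE_summable: "AE t in lborel. summable (\<lambda>m. norm (g m t))"
    using norm_g_sums by (auto simp: sums_iff)
  have "(\<lambda>m. LINT t|lborel. g m t) sums (LINT t|lborel. (\<Sum>m. g m t))"
    by (rule sums_integral[OF int_g AE_summable summable_int])
  also have "(\<lambda>m. LINT t|lborel. g m t) =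
      (\<lambda>m. (LINT t|lborel. e t * ((- of_real (ln t)) ^ m / fact m)) * (w - z) ^ m)"
    by (intro ext) (simp only: g_def power_mult_distrib times_divide_eq_right
        times_divide_eq_left mult.assoc flip: integral_mult_left_zero)
  also have "(\<lambda>t. \<Sum>m. g m t) = (\<lambda>t. f t *\<^sub>R exp (- (w + 1) * of_real (ln t)))"
  proof
    fix t
    have "(\<lambda>m. (- of_real (ln t) * (w - z)) ^ m / fact m) sums exp (- of_real (ln t) * (w - z))"
      using exp_converges[of "- of_real (ln t) * (w - z)"]
      by (simp only: scaleR_conv_of_real divide_inverse of_real_inverse of_real_fact mult.commute)
    from sums_mult[OF this, of "e t"]
    have "(\<lambda>m. g m t) sums (e t * exp (- of_real (ln t) * (w - z)))"
      by (simp only: g_def)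
    hence "(\<Sum>m. g m t) = e t * exp (- of_real (ln t) * (w - z))"
      by (simp only: sums_iff)
    thus "(\<Sum>m. g m t) = f t *\<^sub>R exp (- (w + 1) * of_real (ln t))"
      by (simp add: e_def algebra_simps flip: exp_add)
  qed
  finally show "(\<lambda>m. (LINT t|lborel. e t * ((- of_real (ln t)) ^ m / fact m)) * (w - z) ^ m)
    sums mellin f w" by (simp add: mellin_def)
qed

section \<open>Series of simple poles at the points -j/2\<close>

text \<open>The poles tend to infinity, so only finitely many come near \<open>p\<close>. Taking
  \<open>N > 2 * norm p + 4\<close> keeps the later ones at distance at least 1 from the whole ball,
  which makes \<open>\<bar>\<gamma> j\<bar>\<close> a majorant independent of
  \<open>b\<close>.\<close>

lemma eventually_pole_term_bound:
  fixes \<gamma> :: "nat \<Rightarrow> real" and p :: complex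
  obtains N where "\<And>b j. b \<in> ball p 1 \<Longrightarrow> j \<ge> N \<Longrightarrow> norm (b + of_nat j / 2) \<ge> 1"
    "\<And>b j. b \<in> ball p 1 \<Longrightarrow> j \<ge> N \<Longrightarrow> norm (of_real (\<gamma> j) / (b + of_nat j / 2)) \<le> \<bar>\<gamma> j\<bar>"
proof -
  obtain N :: nat where N: "real N > 2 * norm p + 4"
    using reals_Archimedean2 by blast
  have big: "norm (b + of_nat j / 2) \<ge> 1" if "b \<in> ball p 1" "j \<ge> N" for b j
  proof -
    have "norm b \<le> norm p + 1"
      using that norm_triangle_ineq2[of b p] by (auto simp: dist_norm norm_minus_commute)
    moreover have "norm (of_nat j / 2 :: complex) \<ge> real N / 2"
      using that by (simp add: norm_divide)
    ultimately show ?thesis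
      using norm_diff_ineq[of "of_nat j / 2" b] N by (simp add: add.commute)
  qed
  moreover have "norm (of_real (\<gamma> j) / (b + of_nat j / 2)) \<le> \<bar>\<gamma> j\<bar>"
    if "b \<in> ball p 1" "j \<ge> N" for b j
  proof -
    have "\<bar>\<gamma> j\<bar> / norm (b + of_nat j / 2) \<le> \<bar>\<gamma> j\<bar> / 1"
      using big[OF that] by (intro divide_left_mono) auto
    thus ?thesis by (simp add: norm_divide)
  qed
  ultimately show ?thesis using that by blast
qed

lemma pole_series_summable:
  fixes \<gamma> :: "nat \<Rightarrow> real" and b :: complex
  assumes "summable (\<lambda>j. \<bar>\<gamma> j\<bar>)"
  shows "summable (\<lambda>j. of_real (\<gamma> j) / (b + of_nat j / 2))"
proof -
  obtain N where "\<And>b' j. b' \<in> ball b 1 \<Longrightarrow> j \<ge> N \<Longrightarrow> norm (b' + of_nat j / 2) \<ge> 1"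
    and N: "\<And>b' j. b' \<in> ball b 1 \<Longrightarrow> j \<ge> N \<Longrightarrow>
      norm (of_real (\<gamma> j) / (b' + of_nat j / 2)) \<le> \<bar>\<gamma> j\<bar>"
    using eventually_pole_term_bound[of b \<gamma>] by blast
  show ?thesis
    by (rule summable_comparison_test'[OF assms, of N]) (rule N, auto)
qed

text \<open>The tail is holomorphic by uniform convergence, and the finitely many other terms are
  treated singly. A pole is excluded only where \<open>\<gamma> j\<close> is nonzero, so that
  setting a coefficient to 0 amounts to removing its pole.\<close>

lemma pole_series_analytic:
  fixes \<gamma> :: "nat \<Rightarrow> real"
  assumes summ: "summable (\<lambda>j. \<bar>\<gamma> j\<bar>)" and nz: "\<And>j. \<gamma> j \<noteq> 0 \<Longrightarrow> p \<noteq> - (of_nat j / 2)"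
  shows "(\<lambda>b. \<Sum>j. of_real (\<gamma> j) / (b + of_nat j / 2)) analytic_on {p :: complex}"
proof -
  let ?f = "\<lambda>j b. of_real (\<gamma> j) / (b + of_nat j / 2 :: complex)"
  obtain N where big: "\<And>b j. b \<in> ball p 1 \<Longrightarrow> j \<ge> N \<Longrightarrow> norm (b + of_nat j / 2) \<ge> 1"
    and bound: "\<And>b j. b \<in> ball p 1 \<Longrightarrow> j \<ge> N \<Longrightarrow> norm (?f j b) \<le> \<bar>\<gamma> j\<bar>"
    using eventually_pole_term_bound[of p \<gamma>] by blast
  have "(\<lambda>b. \<Sum>j. ?f (j + N) b) holomorphic_on ball p 1"
  proof (rule holomorphic_on_suminf)
    show "?f (j + N) holomorphic_on ball p 1" for j
      using big[of _ "j + N"] by (intro holomorphic_intros) (force simp del: of_nat_add)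
    show "norm (?f (j + N) b) \<le> \<bar>\<gamma> (j + N)\<bar>" if "b \<in> ball p 1" for j b
      using that by (intro bound) auto
    show "summable (\<lambda>j. \<bar>\<gamma> (j + N)\<bar>)"
      using summ by (rule summable_ignore_initial_segment)
  qed auto
  hence "(\<lambda>b. \<Sum>j. ?f (j + N) b) analytic_on ball p 1"
    by (simp add: analytic_on_open)
  hence tail: "(\<lambda>b. \<Sum>j. ?f (j + N) b) analytic_on {p}"
    by (rule analytic_on_subset) auto
  have "?f j analytic_on {p}" for j
  proof (cases "\<gamma> j = 0")
    case False
    hence "p + of_nat j / 2 \<noteq> 0"
      using nz[of j] by (metis add_eq_0_iff2)
    thus ?thesis by (intro analytic_intros) auto
  qed auto
  hence "(\<lambda>b. (\<Sum>j. ?f (j + N) b) + (\<Sum>j<N. ?f j b)) analytic_on {p}"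
    by (intro analytic_on_add analytic_on_sum tail)
  also have "(\<lambda>b. (\<Sum>j. ?f (j + N) b) + (\<Sum>j<N. ?f j b)) = (\<lambda>b. \<Sum>j. ?f j b)"
    by (intro ext suminf_split_initial_segment[symmetric] pole_series_summable summ)
  finally show ?thesis .
qed

text \<open>Splits off the singular part at -m/2. The identity holds even at the pole itself, where
  the quotient by zero is 0 on both sides.\<close>

lemma pole_series_remove_term:
  fixes \<gamma> :: "nat \<Rightarrow> real"
  assumes summ: "summable (\<lambda>j. \<bar>\<gamma> j\<bar>)"
  obtains h where "h analytic_on {- (of_nat m / 2 :: complex)}"
    "\<And>b. (\<Sum>j. of_real (\<gamma> j) / (b + of_nat j / 2)) = of_real (\<gamma> m) / (b + of_nat m / 2) + h b"
proof -
  let ?h = "\<lambda>b. \<Sum>j. of_real ((\<gamma>(m := 0)) j) / (b + of_nat j / 2 :: complex)"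
  have summ': "summable (\<lambda>j. \<bar>(\<gamma>(m := 0)) j\<bar>)"
    using summ by (rule summable_comparison_test'[where N = 0]) auto
  have "?h analytic_on {- (of_nat m / 2)}"
    by (intro pole_series_analytic summ') (auto split: if_splits)
  moreover have "(\<Sum>j. of_real (\<gamma> j) / (b + of_nat j / 2)) =
      of_real (\<gamma> m) / (b + of_nat m / 2) + ?h b" for b :: complex
  proof -
    have "(\<lambda>j. if j = m then of_real (\<gamma> m) / (b + of_nat m / 2) else 0) sums
        (of_real (\<gamma> m) / (b + of_nat m / 2))"
      using sums_If_finite_set[of "{m}" "\<lambda>j. of_real (\<gamma> m) / (b + of_nat m / 2)"] by simp
    moreover have "(\<lambda>j. of_real ((\<gamma>(m := 0)) j) / (b + of_nat j / 2)) sums ?h b"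
      by (intro summable_sums pole_series_summable summ')
    ultimately have "(\<lambda>j. (if j = m then of_real (\<gamma> m) / (b + of_nat m / 2) else 0) +
        of_real ((\<gamma>(m := 0)) j) / (b + of_nat j / 2)) sums
        (of_real (\<gamma> m) / (b + of_nat m / 2) + ?h b)"
      by (rule sums_add)
    also have "(\<lambda>j. (if j = m then of_real (\<gamma> m) / (b + of_nat m / 2) else 0) +
        of_real ((\<gamma>(m := 0)) j) / (b + of_nat j / 2)) =
        (\<lambda>j. of_real (\<gamma> j) / (b + of_nat j / 2))"
      by auto
    finally show ?thesis by (simp add: sums_iff)
  qed
  ultimately show ?thesis using that by blast
qed

section \<open>Explicit integrals from the Gamma function\<close>

text \<open>Substitution t -> c t in Euler's integral. The integrals of this part are computed in
  the extended nonnegative reals, where order may be exchanged without prior integrability and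
  finiteness comes with the value.\<close>

lemma nn_integral_Gamma_scaled:
  fixes a c :: real
  assumes "a > 0" "c > 0"
  shows "(\<integral>\<^sup>+ t. ennreal (indicator {0<..} t * (t powr (a - 1) * exp (- (c * t)))) \<partial>lborel) =
    ennreal (Gamma a * c powr (- a))"
proof -
  let ?g = "\<lambda>t. ennreal (indicator {0<..} t * (t powr (a - 1) * exp (- t)))"
  have "ennreal (Gamma a) = (\<integral>\<^sup>+ t. ennreal (indicator {0..} t * t powr (a - 1) / exp t) \<partial>lborel)"
    using \<open>a > 0\<close> by (rule Gamma_conv_nn_integral_real)
  also have "\<dots> = (\<integral>\<^sup>+ t. ?g t \<partial>lborel)"
    by (rule nn_integral_cong_AE)
       (use AE_lborel_singleton[of 0] in \<open>auto elim!: eventually_mono simp: indicator_def exp_minus field_simps\<close>)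
  also have "\<dots> = ennreal \<bar>c\<bar> * (\<integral>\<^sup>+ t. ?g (0 + c * t) \<partial>lborel)"
    using \<open>c > 0\<close> by (intro nn_integral_real_affine) auto
  also have "\<dots> = (\<integral>\<^sup>+ t. ennreal c * ?g (0 + c * t) \<partial>lborel)"
    using \<open>c > 0\<close> by (simp add: nn_integral_cmult)
  also have "\<dots> = (\<integral>\<^sup>+ t. ennreal (c powr a) *
      ennreal (indicator {0<..} t * (t powr (a - 1) * exp (- (c * t)))) \<partial>lborel)"
  proof (rule nn_integral_cong)
    fix t :: real
    show "ennreal c * ?g (0 + c * t) = ennreal (c powr a) *
      ennreal (indicator {0<..} t * (t powr (a - 1) * exp (- (c * t))))"
    proof (cases "t > 0")
      case True
      have "c powr a = c * c powr (a - 1)"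
        using \<open>c > 0\<close> by (simp add: powr_mult_base)
      thus ?thesis
        using True \<open>c > 0\<close> by (simp add: powr_mult mult_ac flip: ennreal_mult)
    qed (use \<open>c > 0\<close> in \<open>auto simp: zero_less_mult_iff\<close>)
  qed
  also have "\<dots> = ennreal (c powr a) *
      (\<integral>\<^sup>+ t. ennreal (indicator {0<..} t * (t powr (a - 1) * exp (- (c * t)))) \<partial>lborel)"
    by (rule nn_integral_cmult) auto
  finally have eq: "ennreal (Gamma a) = \<dots>" .
  have "ennreal (Gamma a * c powr (- a)) = ennreal (c powr (- a)) * ennreal (Gamma a)"
    by (simp add: ennreal_mult'' mult.commute)
  also have "\<dots> = ennreal (c powr (- a) * c powr a) *
      (\<integral>\<^sup>+ t. ennreal (indicator {0<..} t * (t powr (a - 1) * exp (- (c * t)))) \<partial>lborel)"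
    unfolding eq by (simp add: ennreal_mult mult.assoc)
  also have "c powr (- a) * c powr a = 1"
    using \<open>c > 0\<close> by (simp flip: powr_add)
  finally show ?thesis by simp
qed

text \<open>Write 1 / (1 + u t) as the integral of exp (-(1 + u t) x) over x > 0 and integrate over
  t first: this gives Gamma (1 - b), the remaining integral gives Gamma b, and the reflection
  formula turns their product into pi / sin (pi b).\<close>

lemma nn_integral_powr_divide_one_plus:
  fixes b u :: real
  assumes "0 < b" "b < 1" "u > 0"
  shows "(\<integral>\<^sup>+ t. ennreal (indicator {0<..} t * (t powr (- b) / (1 + u * t))) \<partial>lborel) =
    ennreal (u powr (b - 1) * (pi / sin (pi * b)))"
proof -
  let ?k = "\<lambda>t x. indicator {0<..} t * (t powr (- b) * (indicator {0<..} x * exp (- ((1 + u * t) * x))))"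
  have "(\<integral>\<^sup>+ t. ennreal (indicator {0<..} t * (t powr (- b) / (1 + u * t))) \<partial>lborel) =
    (\<integral>\<^sup>+ t. (\<integral>\<^sup>+ x. ennreal (?k t x) \<partial>lborel) \<partial>lborel)"
  proof (rule nn_integral_cong)
    fix t :: real
    show "ennreal (indicator {0<..} t * (t powr (- b) / (1 + u * t))) =
      (\<integral>\<^sup>+ x. ennreal (?k t x) \<partial>lborel)"
    proof (cases "t > 0")
      case True
      hence pos: "1 + u * t > 0" using \<open>u > 0\<close> by (simp add: add_pos_pos)
      have "(\<integral>\<^sup>+ x. ennreal (?k t x) \<partial>lborel) =
        (\<integral>\<^sup>+ x. ennreal (t powr (- b)) * ennreal (indicator {0<..} x * (x powr (1 - 1) * exp (- ((1 + u * t) * x)))) \<partial>lborel)"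
        using True by (intro nn_integral_cong) (auto simp: indicator_def ennreal_mult)
      also have "\<dots> = ennreal (t powr (- b)) * ennreal (Gamma 1 * (1 + u * t) powr (- 1))"
        using nn_integral_Gamma_scaled[OF _ pos, of 1] by (subst nn_integral_cmult) auto
      finally show ?thesis
        using True pos by (simp add: powr_minus divide_inverse flip: ennreal_mult)
    qed auto
  qed
  also have "\<dots> = (\<integral>\<^sup>+ x. (\<integral>\<^sup>+ t. ennreal (?k t x) \<partial>lborel) \<partial>lborel)"
    by (rule lborel_pair.Fubini') measurable
  also have "\<dots> = (\<integral>\<^sup>+ x. ennreal (Gamma (1 - b) * u powr (b - 1)) *
      ennreal (indicator {0<..} x * (x powr (b - 1) * exp (- (1 * x)))) \<partial>lborel)"
  proof (rule nn_integral_cong)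
    fix x :: real
    show "(\<integral>\<^sup>+ t. ennreal (?k t x) \<partial>lborel) = ennreal (Gamma (1 - b) * u powr (b - 1)) *
      ennreal (indicator {0<..} x * (x powr (b - 1) * exp (- (1 * x))))"
    proof (cases "x > 0")
      case True
      have "(\<integral>\<^sup>+ t. ennreal (?k t x) \<partial>lborel) =
        (\<integral>\<^sup>+ t. ennreal (exp (- x)) *
          ennreal (indicator {0<..} t * (t powr ((1 - b) - 1) * exp (- ((u * x) * t)))) \<partial>lborel)"
        using True by (intro nn_integral_cong)
          (auto simp: indicator_def algebra_simps simp flip: ennreal_mult exp_add)
      also have "\<dots> = ennreal (exp (- x)) * ennreal (Gamma (1 - b) * (u * x) powr (- (1 - b)))"
        using nn_integral_Gamma_scaled[of "1 - b" "u * x"] True assms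
        by (subst nn_integral_cmult) auto
      finally show ?thesis
        using True assms by (simp add: powr_mult Gamma_real_pos mult_ac flip: ennreal_mult)
    qed auto
  qed
  also have "\<dots> = ennreal (Gamma (1 - b) * u powr (b - 1)) * ennreal (Gamma b * 1 powr (- b))"
    using nn_integral_Gamma_scaled[of b 1] assms by (subst nn_integral_cmult) auto
  also have "\<dots> = ennreal (u powr (b - 1) * (Gamma b * Gamma (1 - b)))"
    using assms by (simp add: Gamma_real_pos mult_ac flip: ennreal_mult)
  also have "Gamma b * Gamma (1 - b) = pi / sin (pi * b)"
  proof -
    have "complex_of_real (Gamma b * Gamma (1 - b)) = Gamma (of_real b) * Gamma (1 - of_real b)"
      using Gamma_complex_of_real[of b] Gamma_complex_of_real[of "1 - b"] by simp
    also have "\<dots> = of_real (pi / sin (pi * b))"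
      unfolding Gamma_reflection_complex
      by (simp only: of_real_mult of_real_divide flip: sin_of_real)
    finally show ?thesis by (simp only: of_real_eq_iff)
  qed
  finally show ?thesis .
qed

text \<open>Since ln (1 + v t) / t is the integral of 1 / (1 + u t) over 0 < u < v, exchanging the
  integrals reduces to the previous formula and leaves the integral of u^(b-1), whose factor 1/b
  joins the sine.\<close>

lemma nn_integral_ln_one_plus_powr:
  fixes b v :: real
  assumes "0 < b" "b < 1" "v > 0"
  shows "(\<integral>\<^sup>+ t. ennreal (indicator {0<..} t * (ln (1 + v * t) * t powr (- b - 1))) \<partial>lborel) =
    ennreal (v powr b * (pi / (b * sin (pi * b))))"
proof -
  let ?k = "\<lambda>t u. indicator {0<..} t * (indicator {0<..v} u * (t powr (- b) / (1 + u * t)))"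
  have "sin (pi * b) > 0"
    using assms by (intro sin_gt_zero) auto
  have "(\<integral>\<^sup>+ t. ennreal (indicator {0<..} t * (ln (1 + v * t) * t powr (- b - 1))) \<partial>lborel) =
    (\<integral>\<^sup>+ t. (\<integral>\<^sup>+ u. ennreal (?k t u) \<partial>lborel) \<partial>lborel)"
  proof (rule nn_integral_cong)
    fix t :: real
    show "ennreal (indicator {0<..} t * (ln (1 + v * t) * t powr (- b - 1))) =
      (\<integral>\<^sup>+ u. ennreal (?k t u) \<partial>lborel)"
    proof (cases "t > 0")
      case True
      have pos: "1 + u * t > 0" if "0 \<le> u" for u
        using True that by (intro add_pos_nonneg) auto
      have "(\<integral>\<^sup>+ u. ennreal (?k t u) \<partial>lborel) =
        (\<integral>\<^sup>+ u. ennreal (t powr (- b) / (1 + u * t)) * indicator {0..v} u \<partial>lborel)"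
        by (rule nn_integral_cong_AE)
           (use AE_lborel_singleton[of 0] True in \<open>auto elim!: eventually_mono simp: indicator_def\<close>)
      also have "\<dots> = ennreal (t powr (- b - 1) * ln (1 + v * t) - t powr (- b - 1) * ln (1 + 0 * t))"
      proof (rule nn_integral_FTC_Icc[where F = "\<lambda>u. t powr (- b - 1) * ln (1 + u * t)"])
        fix u assume "u \<in> {0..v}"
        hence "0 \<le> u" by simp
        show "((\<lambda>u. t powr (- b - 1) * ln (1 + u * t)) has_real_derivative t powr (- b) / (1 + u * t)) (at u)"
          using pos[OF \<open>0 \<le> u\<close>] True
          by (auto intro!: derivative_eq_intros simp: powr_diff)
        show "0 \<le> t powr (- b) / (1 + u * t)"
          using pos[OF \<open>0 \<le> u\<close>] by simp
      qed (use \<open>v > 0\<close> in auto)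
      finally show ?thesis using True by (simp add: mult.commute)
    qed auto
  qed
  also have "\<dots> = (\<integral>\<^sup>+ u. (\<integral>\<^sup>+ t. ennreal (?k t u) \<partial>lborel) \<partial>lborel)"
    by (rule lborel_pair.Fubini') measurable
  also have "\<dots> = (\<integral>\<^sup>+ u. ennreal (pi / sin (pi * b)) *
      (ennreal (u powr (b - 1)) * indicator {0<..v} u) \<partial>lborel)"
  proof (rule nn_integral_cong)
    fix u :: real
    show "(\<integral>\<^sup>+ t. ennreal (?k t u) \<partial>lborel) = ennreal (pi / sin (pi * b)) *
      (ennreal (u powr (b - 1)) * indicator {0<..v} u)"
    proof (cases "u \<in> {0<..v}")
      case True
      hence "(\<integral>\<^sup>+ t. ennreal (?k t u) \<partial>lborel) =
          (\<integral>\<^sup>+ t. ennreal (indicator {0<..} t * (t powr (- b) / (1 + u * t))) \<partial>lborel)"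
        by simp
      also have "\<dots> = ennreal (u powr (b - 1) * (pi / sin (pi * b)))"
        using assms True by (intro nn_integral_powr_divide_one_plus) auto
      finally show ?thesis
        using True \<open>sin (pi * b) > 0\<close> by (simp add: mult_ac flip: ennreal_mult)
    qed auto
  qed
  also have "\<dots> = ennreal (pi / sin (pi * b)) * (\<integral>\<^sup>+ u. ennreal (u powr (b - 1)) * indicator {0<..v} u \<partial>lborel)"
    by (rule nn_integral_cmult) auto
  also have "(\<integral>\<^sup>+ u. ennreal (u powr (b - 1)) * indicator {0<..v} u \<partial>lborel) = ennreal (v powr b / b)"
  proof -
    have "((\<lambda>u. u powr (b - 1)) has_integral (v powr (b - 1 + 1) / (b - 1 + 1))) {0..v}"
      using assms by (intro has_integral_powr_from_0) auto
    from nn_integral_has_integral_lebesgue[OF _ this]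
    have "(\<integral>\<^sup>+ u. ennreal (indicator {0..v} u * u powr (b - 1)) \<partial>lborel) = ennreal (v powr b / b)"
      by simp
    also have "(\<integral>\<^sup>+ u. ennreal (indicator {0..v} u * u powr (b - 1)) \<partial>lborel) =
      (\<integral>\<^sup>+ u. ennreal (u powr (b - 1)) * indicator {0<..v} u \<partial>lborel)"
      by (rule nn_integral_cong_AE)
         (use AE_lborel_singleton[of 0] in \<open>auto elim!: eventually_mono simp: indicator_def\<close>)
    finally show ?thesis .
  qed
  also have "ennreal (pi / sin (pi * b)) * ennreal (v powr b / b) = ennreal (v powr b * (pi / (b * sin (pi * b))))"
    using \<open>sin (pi * b) > 0\<close> assms by (simp add: mult_ac flip: ennreal_mult)
  finally show ?thesis .
qed

section \<open>The products \<open>\<Phi>\<close> and \<open>\<phi>\<close>\<close>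

text \<open>The product majorant gives the partial row sums the bound
  \<open>A n * (\<Sum>j. B j)\<close>, uniform in the cutoff, so Tannery's theorem lets the limit
  pass inside the sum over \<open>n\<close>.\<close>

lemma sums_swap_product_bound:
  fixes f :: "nat \<Rightarrow> nat \<Rightarrow> real"
  assumes row: "\<And>n. f n sums s n"
    and bound: "\<And>n j. \<bar>f n j\<bar> \<le> A n * B j"
    and A: "summable A" "\<And>n. A n \<ge> 0" and B: "summable B" "\<And>j. B j \<ge> 0"
  shows "(\<lambda>j. \<Sum>n. f n j) sums (\<Sum>n. s n)"
proof -
  have col: "summable (\<lambda>n. f n j)" for j
  proof (rule summable_comparison_test'[where N = 0])
    show "summable (\<lambda>n. A n * B j)" using A(1) by (rule summable_mult2)
  qed (use bound in auto)
  have "(\<Sum>j<N. \<Sum>n. f n j) = (\<Sum>n. \<Sum>j<N. f n j)" for N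
    by (intro suminf_sum[symmetric] col)
  moreover have "(\<lambda>N. \<Sum>n. \<Sum>j<N. f n j) \<longlonglongrightarrow> (\<Sum>n. s n)"
  proof (rule conjunct2[OF conjunct2[OF tannerys_theorem]])
    show "((\<lambda>N. \<Sum>j<N. f n j) \<longlongrightarrow> s n) sequentially" for n
      using row by (simp add: sums_def)
    have "norm (\<Sum>j<N. f n j) \<le> A n * (\<Sum>j. B j)" for n N
    proof -
      have "norm (\<Sum>j<N. f n j) \<le> (\<Sum>j<N. A n * B j)"
        using bound by (intro sum_norm_le) auto
      also have "\<dots> \<le> A n * (\<Sum>j. B j)"
        using A(2) B by (auto simp flip: sum_distrib_left intro!: mult_left_mono sum_le_suminf)
      finally show ?thesis .
    qed
    thus "\<forall>\<^sub>F (n, N) in sequentially \<times>\<^sub>F sequentially. norm (\<Sum>j<N. f n j) \<le> A n * (\<Sum>j. B j)"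
      by (intro always_eventually) auto
    show "summable (\<lambda>n. A n * (\<Sum>j. B j))"
      using A(1) by (rule summable_mult2)
  qed auto
  ultimately show ?thesis by (simp add: sums_def)
qed

lemma has_prod_exp_suminf_Ln:
  fixes f :: "nat \<Rightarrow> complex"
  assumes "\<And>n. f n \<noteq> 0" "summable (\<lambda>n. Ln (f n))"
  shows "f has_prod exp (\<Sum>n. Ln (f n))"
  using sums_imp_has_prod_exp[OF summable_sums[OF assms(2)]] assms(1) by (simp add: has_prod_def)

text \<open>In terms of m = \<open>Suc n\<close> the bound says m <= \<tau>_m; nothing is said about
  \<open>\<tau> 0\<close>. The bound makes the power sums of exponent above 1 converge and keeps the
  zeros of \<Phi> out of the open unit disc; monotonicity serves Leibniz's criterion.\<close>

locale linear_growth_zeros =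
  fixes \<tau> :: "nat \<Rightarrow> real"
  assumes tau_ge: "\<And>n. \<tau> (Suc n) \<ge> real n + 1"
    and tau_mono: "\<And>n. \<tau> (Suc n) \<le> \<tau> (Suc (Suc n))"
begin

lemma tau_pos: "\<tau> (Suc n) > 0"
  using tau_ge[of n] by linarith

lemma inverse_tau_power_le:
  assumes "m \<ge> 2"
  shows "1 / \<tau> (Suc n) ^ m \<le> 1 / (real n + 1)\<^sup>2"
proof -
  have "(real n + 1)\<^sup>2 \<le> (real n + 1) ^ m"
    using assms by (intro power_increasing) auto
  also have "\<dots> \<le> \<tau> (Suc n) ^ m"
    using tau_ge by (intro power_mono) auto
  finally show ?thesis using tau_pos[of n]
    by (intro divide_left_mono) (auto intro!: mult_pos_pos)
qed

lemma summable_inverse_squares: "summable (\<lambda>n. 1 / (real n + 1)\<^sup>2)"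
  using sums_summable[OF inverse_squares_sums] by (simp add: add.commute)

lemma summable_inverse_tau_power:
  assumes "m \<ge> 2"
  shows "summable (\<lambda>n. 1 / \<tau> (Suc n) ^ m)"
  by (rule summable_comparison_test'[OF summable_inverse_squares, where N = 0])
     (use inverse_tau_power_le[OF assms] in \<open>auto simp: abs_of_pos tau_pos\<close>)

text \<open>The comparison with 1/n fails for exponent 1, so convergence comes from the alternating
  signs.\<close>

lemma summable_alternating: "summable (\<lambda>n. (-1) ^ Suc n / \<tau> (Suc n))"
proof -
  have "(\<lambda>n. 1 / \<tau> (Suc n)) \<longlonglongrightarrow> 0"
  proof (rule Lim_null_comparison)
    show "\<forall>\<^sub>F n in sequentially. norm (1 / \<tau> (Suc n)) \<le> 1 / real (Suc n)"
      using tau_ge tau_pos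
      by (intro always_eventually allI) (auto simp: abs_of_pos add.commute intro!: divide_left_mono)
    show "(\<lambda>n. 1 / real (Suc n)) \<longlonglongrightarrow> 0"
      by (rule LIMSEQ_Suc) (rule lim_1_over_n)
  qed
  hence "summable (\<lambda>n. (-1) ^ n * (1 / \<tau> (Suc n)))"
    using tau_pos tau_mono by (intro summable) (auto intro!: divide_left_mono simp: less_imp_le)
  hence "summable (\<lambda>n. - ((-1) ^ n * (1 / \<tau> (Suc n))))"
    by (rule summable_minus)
  thus ?thesis by simp
qed

text \<open>Split Ln (1 + u) as u + (Ln (1 + u) - u). The linear parts sum by alternation; the rest
  is at most 2 |u|^2 once |u| <= 1/2, hence absolutely summable. Excluding vanishing factors lets
  the product be the exponential of this sum.\<close>

lemma HB_Phi_has_prod: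
  assumes nz: "\<And>n. 1 + (-1) ^ Suc n * (z / of_real (\<tau> (Suc n))) \<noteq> (0 :: complex)"
  shows "summable (\<lambda>n. Ln (1 + (-1) ^ Suc n * (z / of_real (\<tau> (Suc n)))))"
    "(\<lambda>n. 1 + (-1) ^ Suc n * (z / of_real (\<tau> (Suc n)))) has_prod HB_Phi \<tau> z"
    "HB_Phi \<tau> z = exp (\<Sum>n. Ln (1 + (-1) ^ Suc n * (z / of_real (\<tau> (Suc n)))))"
proof -
  define u where "u = (\<lambda>n. (-1) ^ Suc n * (z / of_real (\<tau> (Suc n))))"
  have norm_u: "norm (u n) = norm z / \<tau> (Suc n)" for n
    using tau_pos[of n] by (simp add: u_def norm_mult norm_divide norm_power)
  have sum1: "summable u"
  proof -
    have "summable (\<lambda>n. of_real ((-1) ^ Suc n / \<tau> (Suc n)) * z)"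
      using summable_alternating by (intro summable_mult2) (simp only: summable_of_real_iff)
    also have "(\<lambda>n. of_real ((-1) ^ Suc n / \<tau> (Suc n)) * z) = u"
      by (auto simp: u_def)
    finally show ?thesis .
  qed
  obtain N :: nat where N: "real N \<ge> 2 * norm z"
    using real_arch_simple by blast
  have sum2: "summable (\<lambda>n. Ln (1 + u n) - u n)"
  proof (rule summable_comparison_test'[where N = N])
    show "summable (\<lambda>n. 2 * (norm z)\<^sup>2 * (1 / \<tau> (Suc n) ^ 2))"
      by (intro summable_mult summable_inverse_tau_power) auto
    fix n assume "n \<ge> N"
    have "norm (u n) \<le> 1 / 2"
    proof -
      have "2 * norm z \<le> \<tau> (Suc n)"
        using N \<open>n \<ge> N\<close> tau_ge[of n] by linarith
      thus ?thesis using tau_pos[of n] by (simp add: norm_u field_simps)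
    qed
    hence "norm (Ln (1 + u n) - u n) \<le> norm (u n) ^ 2 / (1 - norm (u n))"
      by (intro Ln_approx_linear) auto
    also have "\<dots> \<le> norm (u n) ^ 2 / (1 / 2)"
      using \<open>norm (u n) \<le> 1 / 2\<close> by (intro divide_left_mono) auto
    finally show "norm (Ln (1 + u n) - u n) \<le> 2 * (norm z)\<^sup>2 * (1 / \<tau> (Suc n) ^ 2)"
      by (simp add: norm_u power_divide mult.commute)
  qed
  have "summable (\<lambda>n. Ln (1 + u n))"
    using summable_add[OF sum1 sum2] by simp
  thus S: "summable (\<lambda>n. Ln (1 + (-1) ^ Suc n * (z / of_real (\<tau> (Suc n)))))"
    by (simp only: u_def)
  from has_prod_exp_suminf_Ln[OF nz S]
  show *: "HB_Phi \<tau> z = exp (\<Sum>n. Ln (1 + (-1) ^ Suc n * (z / of_real (\<tau> (Suc n)))))"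
    unfolding HB_Phi_def by (rule has_prod_unique[symmetric])
  show "(\<lambda>n. 1 + (-1) ^ Suc n * (z / of_real (\<tau> (Suc n)))) has_prod HB_Phi \<tau> z"
    unfolding * by (rule has_prod_exp_suminf_Ln[OF nz S])
qed

section \<open>Real logarithms of the two products\<close>

definition log_Phi :: "real \<Rightarrow> real" where
  "log_Phi w = (\<Sum>n. ln (1 + (-1) ^ Suc n * (w / \<tau> (Suc n))))"

lemma one_plus_real_pos:
  assumes "\<bar>w\<bar> < 1"
  shows "1 + (-1) ^ Suc n * (w / \<tau> (Suc n)) > 0"
proof -
  have "\<bar>(-1) ^ Suc n * (w / \<tau> (Suc n))\<bar> < 1"
    using assms tau_ge[of n] tau_pos[of n] by (simp add: abs_mult power_abs)
  thus ?thesis by linarith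
qed

lemma HB_Phi_of_real:
  assumes "\<bar>w\<bar> < 1"
  shows "summable (\<lambda>n. ln (1 + (-1) ^ Suc n * (w / \<tau> (Suc n))))"
    "HB_Phi \<tau> (of_real w) = of_real (exp (log_Phi w))"
proof -
  have eq: "1 + (-1) ^ Suc n * (of_real w / of_real (\<tau> (Suc n))) =
      complex_of_real (1 + (-1) ^ Suc n * (w / \<tau> (Suc n)))" for n
    by simp
  have Ln_eq: "Ln (1 + (-1) ^ Suc n * (of_real w / of_real (\<tau> (Suc n)))) =
      of_real (ln (1 + (-1) ^ Suc n * (w / \<tau> (Suc n))))" for n
    unfolding eq by (rule Ln_of_real) (rule one_plus_real_pos[OF assms])
  have nz: "1 + (-1) ^ Suc n * (of_real w / of_real (\<tau> (Suc n))) \<noteq> (0 :: complex)" for n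
    unfolding eq of_real_eq_0_iff using one_plus_real_pos[OF assms, of n] by linarith
  show S: "summable (\<lambda>n. ln (1 + (-1) ^ Suc n * (w / \<tau> (Suc n))))"
    using HB_Phi_has_prod(1)[OF nz] unfolding Ln_eq by (simp only: summable_of_real_iff)
  show "HB_Phi \<tau> (of_real w) = of_real (exp (log_Phi w))"
    unfolding HB_Phi_has_prod(3)[OF nz] Ln_eq suminf_of_real[OF S, symmetric] log_Phi_def exp_of_real ..
qed

text \<open>\<open>log_phi t\<close> is \<open>ln \<phi>\<close> at \<open>\<i> * sqrt t\<close>, and \<open>log_Phi\<close> is \<open>ln \<Phi>\<close> on \<open>(-1, 1)\<close>.\<close>
definition log_phi :: "real \<Rightarrow> real" where
  "log_phi t = (\<Sum>n. ln (1 + 1 / \<tau> (Suc n) ^ 2 * t))"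

lemma log_phi_term_bounds:
  assumes "t \<ge> 0"
  shows "0 \<le> ln (1 + 1 / \<tau> (Suc n) ^ 2 * t)" "ln (1 + 1 / \<tau> (Suc n) ^ 2 * t) \<le> 1 / \<tau> (Suc n) ^ 2 * t"
  using assms by (auto intro!: ln_add_one_self_le_self ln_ge_zero)

lemma summable_log_phi:
  assumes "t \<ge> 0"
  shows "summable (\<lambda>n. ln (1 + 1 / \<tau> (Suc n) ^ 2 * t))"
proof (rule summable_comparison_test'[where N = 0])
  show "summable (\<lambda>n. 1 / \<tau> (Suc n) ^ 2 * t)"
    by (intro summable_mult2 summable_inverse_tau_power) auto
qed (use log_phi_term_bounds[OF assms] in auto)

lemma log_phi_nonneg: "t \<ge> 0 \<Longrightarrow> log_phi t \<ge> 0"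
  unfolding log_phi_def by (intro suminf_nonneg summable_log_phi log_phi_term_bounds)

lemma log_phi_le:
  assumes "t \<ge> 0"
  shows "log_phi t \<le> (\<Sum>n. 1 / \<tau> (Suc n) ^ 2) * t"
proof -
  have "log_phi t \<le> (\<Sum>n. 1 / \<tau> (Suc n) ^ 2 * t)"
    unfolding log_phi_def using assms
    by (intro suminf_le log_phi_term_bounds summable_log_phi summable_mult2 summable_inverse_tau_power) auto
  also have "\<dots> = (\<Sum>n. 1 / \<tau> (Suc n) ^ 2) * t"
    by (intro suminf_mult2[symmetric] summable_inverse_tau_power) auto
  finally show ?thesis .
qed

lemma log_phi_measurable [measurable]: "log_phi \<in> borel_measurable borel"
  unfolding log_phi_def by measurable

text \<open>Factors of equal index multiply to 1 + y^2 / \<tau>_n^2, since the alternating sign is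
  squared away. On the imaginary axis each factor has real part 1, so none vanishes.\<close>

lemma HB_Phi_imaginary:
  assumes "y > 0"
  shows "HB_Phi \<tau> (\<i> * of_real y) * HB_Phi \<tau> (- (\<i> * of_real y)) = of_real (exp (log_phi (y\<^sup>2)))"
proof -
  have nz: "1 + (-1) ^ Suc n * (z / of_real (\<tau> (Suc n))) \<noteq> (0 :: complex)" if "Re z = 0" for z n
  proof -
    have "Re (1 + (-1) ^ Suc n * (z / of_real (\<tau> (Suc n)))) = 1"
      using that by (cases "even n") auto
    thus ?thesis by (metis zero_complex.sel(1) zero_neq_one)
  qed
  have "(\<lambda>n. (1 + (-1) ^ Suc n * (\<i> * of_real y / of_real (\<tau> (Suc n)))) *
             (1 + (-1) ^ Suc n * (- (\<i> * of_real y) / of_real (\<tau> (Suc n)))))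
      has_prod (HB_Phi \<tau> (\<i> * of_real y) * HB_Phi \<tau> (- (\<i> * of_real y)))"
    by (intro has_prod_mult HB_Phi_has_prod(2) nz) auto
  also have "(\<lambda>n. (1 + (-1) ^ Suc n * (\<i> * of_real y / of_real (\<tau> (Suc n)))) *
             (1 + (-1) ^ Suc n * (- (\<i> * of_real y) / of_real (\<tau> (Suc n))))) =
      (\<lambda>n. of_real (exp (ln (1 + 1 / \<tau> (Suc n) ^ 2 * y\<^sup>2))))"
  proof
    fix n
    have "(1 + (-1) ^ Suc n * (\<i> * of_real y / of_real (\<tau> (Suc n)))) *
             (1 + (-1) ^ Suc n * (- (\<i> * of_real y) / of_real (\<tau> (Suc n)))) =
        1 - ((-1) ^ Suc n)\<^sup>2 * (\<i> * of_real y / of_real (\<tau> (Suc n)))\<^sup>2"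
      by (simp add: algebra_simps power2_eq_square)
    also have "\<dots> = of_real (1 + 1 / \<tau> (Suc n) ^ 2 * y\<^sup>2)"
      by (simp add: power_mult_distrib power_divide flip: power_mult)
    also have "1 + 1 / \<tau> (Suc n) ^ 2 * y\<^sup>2 = exp (ln (1 + 1 / \<tau> (Suc n) ^ 2 * y\<^sup>2))"
      by (intro exp_ln[symmetric] add_pos_nonneg) auto
    finally show "(1 + (-1) ^ Suc n * (\<i> * of_real y / of_real (\<tau> (Suc n)))) *
             (1 + (-1) ^ Suc n * (- (\<i> * of_real y) / of_real (\<tau> (Suc n)))) =
        complex_of_real (exp (ln (1 + 1 / \<tau> (Suc n) ^ 2 * y\<^sup>2)))" .
  qed
  finally have "(\<lambda>n. complex_of_real (exp (ln (1 + 1 / \<tau> (Suc n) ^ 2 * y\<^sup>2)))) has_prod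
      (HB_Phi \<tau> (\<i> * of_real y) * HB_Phi \<tau> (- (\<i> * of_real y)))" .
  moreover have "(\<lambda>n. complex_of_real (exp (ln (1 + 1 / \<tau> (Suc n) ^ 2 * y\<^sup>2)))) has_prod
      of_real (exp (log_phi (y\<^sup>2)))"
    unfolding has_prod_of_real_iff
    unfolding log_phi_def has_prod_def
    by (intro disjI1 sums_imp_has_prod_exp summable_sums summable_log_phi) auto
  ultimately show ?thesis
    using has_prod_unique2 by blast
qed

section \<open>Taylor coefficients of ln \<Phi> at 0\<close>

text \<open>The coefficient of \<open>w ^ j\<close> in \<open>log_Phi w\<close>, a signed power sum.
  Index 0 is set to 0 because \<Phi>(0) = 1; index 1 is the series of
  \<open>summable_alternating\<close>; for even \<open>j\<close> the signs disappear, which is how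
  the values at positive even integers enter.\<close>

definition log_coeff :: "nat \<Rightarrow> real" where
  "log_coeff j = (if j = 0 then 0 else
     - ((-1) ^ j / real j * (\<Sum>n. ((-1) ^ Suc n / \<tau> (Suc n)) ^ j)))"

lemma log_coeff_even:
  assumes "k \<ge> 1"
  shows "log_coeff (2 * k) = - (\<Sum>n. 1 / \<tau> (Suc n) ^ (2 * k)) / real (2 * k)"
  using assms by (simp add: log_coeff_def power_divide flip: power_mult)

text \<open>All power sums with \<open>j \<ge> 2\<close> lie below the sum of 1/n^2, as every
  \<tau>_n is at least n. The alternating coefficient at 1 escapes this comparison and is put into
  the bound by hand.\<close>

lemma log_coeff_bounded: obtains D where "\<And>j. \<bar>log_coeff j\<bar> \<le> D"
proof -
  define D where "D = (\<Sum>n. 1 / (real n + 1)\<^sup>2)"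
  have "D \<ge> 0"
    unfolding D_def by (intro suminf_nonneg summable_inverse_squares) auto
  have "\<bar>log_coeff j\<bar> \<le> max D \<bar>log_coeff 1\<bar>" for j
  proof -
    consider "j = 0" | "j = 1" | "j \<ge> 2" by linarith
    thus ?thesis
    proof cases
      case 1
      thus ?thesis using \<open>D \<ge> 0\<close> by (simp add: log_coeff_def)
    next
      case 3
      have le: "norm (((-1) ^ Suc n / \<tau> (Suc n)) ^ j) \<le> 1 / (real n + 1)\<^sup>2" for n
        using inverse_tau_power_le[OF 3, of n] tau_pos[of n]
        by (simp add: power_abs power_divide abs_of_pos)
      have "\<bar>\<Sum>n. ((-1) ^ Suc n / \<tau> (Suc n)) ^ j\<bar> \<le> D"
        unfolding D_def real_norm_def[symmetric]
        by (intro norm_suminf_le summable_inverse_squares le)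
      moreover have "\<bar>log_coeff j\<bar> \<le> \<bar>\<Sum>n. ((-1) ^ Suc n / \<tau> (Suc n)) ^ j\<bar>"
        using 3 by (simp add: log_coeff_def abs_mult power_abs divide_le_eq mult_le_cancel_left1)
      ultimately show ?thesis by linarith
    qed simp
  qed
  thus ?thesis by (rule that)
qed

text \<open>The double series over n and j cannot be rearranged with the linear terms in it, because
  the available bound does not make them absolutely summable in n. They are subtracted from each
  row, the rest is swapped starting at exponent 2, and their sum returns as the coefficient at
  1.\<close>

lemma log_Phi_sums:
  assumes "\<bar>w\<bar> \<le> 1 / 2"
  shows "(\<lambda>j. log_coeff j * w ^ j) sums log_Phi w"
proof -
  define e where "e = (\<lambda>n. (-1) ^ Suc n / \<tau> (Suc n))"
  define f where "f = (\<lambda>n j. - ((- (e n * w)) ^ (j + 2)) / real (j + 2))"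
  have abs_e: "\<bar>e n\<bar> ^ m = 1 / \<tau> (Suc n) ^ m" for n m
    using tau_pos[of n] by (simp add: e_def power_divide)
  have abs_ew: "\<bar>e n * w\<bar> < 1" for n
  proof -
    have "\<bar>e n\<bar> \<le> 1"
      using abs_e[of n 1] tau_ge[of n] by simp
    hence "\<bar>e n\<bar> * \<bar>w\<bar> \<le> 1 * (1 / 2)"
      using assms by (intro mult_mono) auto
    thus ?thesis by (simp add: abs_mult)
  qed
  \<comment> \<open>In \<open>ln_series'\<close> the term of index 0 is a division by zero, hence 0,
    so dropping two terms subtracts exactly \<open>e n * w\<close>.\<close>
  have row: "f n sums (ln (1 + e n * w) - e n * w)" for n
    using sums_split_initial_segment[OF ln_series'[OF abs_ew[of n]], of 2]
    by (simp add: f_def numeral_2_eq_2)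
  have bound: "\<bar>f n j\<bar> \<le> 1 / (real n + 1)\<^sup>2 * (1 / 2) ^ j" for n j
  proof -
    have "\<bar>f n j\<bar> = \<bar>e n\<bar> ^ (j + 2) * \<bar>w\<bar> ^ (j + 2) / real (j + 2)"
      by (simp add: f_def power_abs abs_mult power_mult_distrib del: power_Suc)
    also have "\<dots> \<le> \<bar>e n\<bar> ^ (j + 2) * \<bar>w\<bar> ^ (j + 2) / 1"
      by (intro divide_left_mono) auto
    also have "\<dots> = (1 / \<tau> (Suc n) ^ (j + 2)) * \<bar>w\<bar> ^ (j + 2)"
      by (simp only: abs_e div_by_1)
    also have "\<dots> \<le> 1 / (real n + 1)\<^sup>2 * (1 / 2) ^ (j + 2)"
      using assms by (intro mult_mono inverse_tau_power_le power_mono) auto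
    also have "\<dots> \<le> 1 / (real n + 1)\<^sup>2 * (1 / 2) ^ j"
      by (intro mult_left_mono power_decreasing) auto
    finally show ?thesis .
  qed
  have "(\<lambda>j. \<Sum>n. f n j) sums (\<Sum>n. ln (1 + e n * w) - e n * w)"
    by (rule sums_swap_product_bound[OF row bound summable_inverse_squares _ summable_geometric]) auto
  also have "(\<Sum>n. ln (1 + e n * w) - e n * w) = log_Phi w - (\<Sum>n. e n) * w"
  proof -
    have s1: "summable (\<lambda>n. ln (1 + e n * w))"
      using HB_Phi_of_real(1)[of w] assms by (simp add: e_def)
    have s2: "summable e"
      using summable_alternating by (simp add: e_def)
    have "log_Phi w = (\<Sum>n. ln (1 + e n * w))"
      by (simp add: log_Phi_def e_def)
    thus ?thesis
      by (simp only: suminf_diff[OF s1 summable_mult2[OF s2], symmetric] suminf_mult2[OF s2])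
  qed
  also have "(\<lambda>j. \<Sum>n. f n j) = (\<lambda>j. log_coeff (j + 2) * w ^ (j + 2))"
  proof
    fix j
    define q where "q = (-1) ^ (j + 2) / real (j + 2)"
    have summ: "summable (\<lambda>n. e n ^ (j + 2))"
      by (rule summable_comparison_test'[OF summable_inverse_tau_power[of "j + 2"], where N = 0])
         (simp, simp only: real_norm_def power_abs abs_e order.refl)
    have "f n j = e n ^ (j + 2) * (- (q * w ^ (j + 2)))" for n
      by (simp add: f_def q_def power_mult_distrib power_minus[of "e n * w"])
    hence "(\<Sum>n. f n j) = (\<Sum>n. e n ^ (j + 2)) * (- (q * w ^ (j + 2)))"
      by (simp only: suminf_mult2[OF summ])
    moreover have "log_coeff (j + 2) = - (q * (\<Sum>n. e n ^ (j + 2)))"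
      unfolding log_coeff_def q_def e_def by (simp only: add_eq_0_iff_both_eq_0) simp
    ultimately show "(\<Sum>n. f n j) = log_coeff (j + 2) * w ^ (j + 2)"
      by (simp only: mult_minus_left mult_minus_right mult_ac)
  qed
  finally have "(\<lambda>j. log_coeff j * w ^ j) sums
      (log_Phi w - (\<Sum>n. e n) * w + (\<Sum>j<2. log_coeff j * w ^ j))"
    by (simp only: sums_iff_shift[of "\<lambda>j. log_coeff j * w ^ j" 2])
  also have "(\<Sum>j<2. log_coeff j * w ^ j) = (\<Sum>n. e n) * w"
    by (simp add: numeral_2_eq_2 log_coeff_def e_def)
  finally show ?thesis by simp
qed

end

section \<open>The functional equation on the imaginary axis\<close>

lemma nn_integral_imp_has_bochner_integral:
  fixes f :: "real \<Rightarrow> real"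
  assumes "f \<in> borel_measurable borel" "\<And>t. f t \<ge> 0" "v \<ge> 0"
    "(\<integral>\<^sup>+ t. ennreal (f t) \<partial>lborel) = ennreal v"
  shows "has_bochner_integral lborel f v"
  using assms by (intro has_bochner_integral_nn_integral) auto

lemma nn_integral_indicator_mult:
  "(\<integral>\<^sup>+ t. ennreal (indicator A t * f t) \<partial>M) = (\<integral>\<^sup>+ t. ennreal (f t) * indicator A t \<partial>M)"
  by (auto intro!: nn_integral_cong simp: indicator_def)

lemma has_bochner_integral_exp_ln_atLeast:
  fixes p Y :: real
  assumes "p > 0" "Y > 0"
  shows "has_bochner_integral lborel (\<lambda>t. indicator {Y..} t * exp (- (p + 1) * ln t)) (exp (- p * ln Y) / p)"
proof (rule nn_integral_imp_has_bochner_integral)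
  have "(\<integral>\<^sup>+ t. ennreal (exp (- (p + 1) * ln t)) * indicator {Y..} t \<partial>lborel) =
      ennreal (0 - (- exp (- p * ln Y) / p))"
  proof (rule nn_integral_FTC_atLeast)
    show "((\<lambda>t. - exp (- p * ln t) / p) \<longlongrightarrow> 0) at_top"
      using \<open>p > 0\<close> by real_asymp
    fix t assume "Y \<le> t"
    hence "t > 0" using \<open>Y > 0\<close> by simp
    thus "((\<lambda>t. - exp (- p * ln t) / p) has_real_derivative exp (- (p + 1) * ln t)) (at t)"
      using \<open>p > 0\<close>
      by (auto intro!: derivative_eq_intros simp: field_simps exp_add exp_diff exp_minus)
  qed auto
  thus "(\<integral>\<^sup>+ t. ennreal (indicator {Y..} t * exp (- (p + 1) * ln t)) \<partial>lborel) = ennreal (exp (- p * ln Y) / p)"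
    unfolding nn_integral_indicator_mult by simp
qed (use \<open>p > 0\<close> in auto)

text \<open>A logarithm in the integrand raises the pole at p = 0 to order two.
  \<open>Y \<ge> 1\<close> keeps the integrand nonnegative.\<close>

lemma has_bochner_integral_ln_exp_ln_atLeast:
  fixes p Y :: real
  assumes "p > 0" "Y \<ge> 1"
  shows "has_bochner_integral lborel (\<lambda>t. indicator {Y..} t * (ln t * exp (- (p + 1) * ln t)))
    (exp (- p * ln Y) * (ln Y / p + 1 / p\<^sup>2))"
proof (rule nn_integral_imp_has_bochner_integral)
  have "(\<integral>\<^sup>+ t. ennreal (ln t * exp (- (p + 1) * ln t)) * indicator {Y..} t \<partial>lborel) =
      ennreal (0 - (- exp (- p * ln Y) * (ln Y / p + 1 / p\<^sup>2)))"
  proof (rule nn_integral_FTC_atLeast)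
    show "((\<lambda>t. - exp (- p * ln t) * (ln t / p + 1 / p\<^sup>2)) \<longlongrightarrow> 0) at_top"
      using \<open>p > 0\<close> by real_asymp
    fix t assume "Y \<le> t"
    hence "t > 0" "t \<ge> 1" using \<open>Y \<ge> 1\<close> by auto
    thus "((\<lambda>t. - exp (- p * ln t) * (ln t / p + 1 / p\<^sup>2)) has_real_derivative ln t * exp (- (p + 1) * ln t)) (at t)"
      using \<open>p > 0\<close>
      by (auto intro!: derivative_eq_intros simp: field_simps exp_add exp_diff exp_minus power2_eq_square)
    show "0 \<le> ln t * exp (- (p + 1) * ln t)"
      using \<open>t \<ge> 1\<close> by simp
  qed auto
  thus "(\<integral>\<^sup>+ t. ennreal (indicator {Y..} t * (ln t * exp (- (p + 1) * ln t))) \<partial>lborel) =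
      ennreal (exp (- p * ln Y) * (ln Y / p + 1 / p\<^sup>2))"
    unfolding nn_integral_indicator_mult by simp
next
  show "0 \<le> indicator {Y..} t * (ln t * exp (- (p + 1) * ln t))" for t
    using \<open>Y \<ge> 1\<close> by (auto simp: indicator_def)
qed (use assms in auto)

lemma integrable_exp_ln_lessThan:
  fixes q Y :: real
  assumes "q > - 1" "Y > 0"
  shows "integrable lborel (\<lambda>t. indicator {0<..<Y} t * exp (q * ln t))"
proof -
  have "((\<lambda>t. t powr q) has_integral (Y powr (q + 1) / (q + 1))) {0..Y}"
    using assms by (intro has_integral_powr_from_0) auto
  from nn_integral_has_integral_lebesgue[OF _ this]
  have fin: "(\<integral>\<^sup>+ t. ennreal (indicator {0..Y} t * t powr q) \<partial>lborel) < \<infinity>"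
    by simp
  show ?thesis
  proof (rule integrableI_bounded)
    have "(\<integral>\<^sup>+ t. ennreal (norm (indicator {0<..<Y} t * exp (q * ln t))) \<partial>lborel) \<le>
        (\<integral>\<^sup>+ t. ennreal (indicator {0..Y} t * t powr q) \<partial>lborel)"
      by (intro nn_integral_mono ennreal_leI) (auto simp: indicator_def powr_def)
    also note fin
    finally show "(\<integral>\<^sup>+ t. ennreal (norm (indicator {0<..<Y} t * exp (q * ln t))) \<partial>lborel) < \<infinity>" .
  qed auto
qed

section \<open>Asymptotics of ln \<phi> on the imaginary axis\<close>

locale inversion_zeros = linear_growth_zeros +
  fixes C :: real
  assumes C_pos: "C > 0" and inversion: "HB_functional_equation \<tau> C"
begin

text \<open>Multiplying the functional equation at \<open>\<i> y\<close> by the one at \<open>- \<i> y\<close>: the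
  cross terms carry the factors \<open>- \<i>\<close> and \<open>\<i>\<close> and cancel.\<close>
lemma exp_log_phi_inversion:
  assumes "y > 0" "w = 1 / (2 * pi * C * y)" "w < 1"
  shows "4 * pi * C * y\<^sup>2 * exp (log_phi (y\<^sup>2)) =
    exp (2 * log_Phi w + pi * y) + exp (2 * log_Phi (- w) - pi * y)"
proof -
  define z where "z = \<i> * complex_of_real y"
  have "w > 0" using assms C_pos by simp
  \<comment> \<open>As \<open>\<i> * \<i> = - 1\<close>, the map \<open>HB_T C\<close> sends the
    imaginary axis to the real one, where small arguments make \<Phi> positive with a real
    logarithm.\<close>
  have T: "HB_T C z = - of_real w" "HB_T C (- z) = of_real w"
  proof -
    have h: "2 * complex_of_real pi * \<i> * of_real C * z = - (2 * of_real pi * of_real C * of_real y)"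
      by (simp add: z_def algebra_simps)
    thus "HB_T C z = - of_real w" "HB_T C (- z) = of_real w"
      by (simp_all only: HB_T_def assms(2) h mult_minus_right) simp_all
  qed
  define \<alpha> \<beta> where "\<alpha> = exp (- (\<i> * pi / 4))" and "\<beta> = exp (\<i> * pi / 4)"
  define e1 e2 where "e1 = complex_of_real (exp (pi * y / 2))" and "e2 = complex_of_real (exp (- (pi * y / 2)))"
  define P Q where "P = complex_of_real (exp (log_Phi w))" and "Q = complex_of_real (exp (log_Phi (- w)))"
  define s where "s = complex_of_real (sqrt (pi * C))"
  define x where "x = exp (1 / (4 * complex_of_real C * z))"
  define x' where "x' = exp (1 / (4 * complex_of_real C * (- z)))"
  have PQ: "HB_Phi \<tau> (of_real w) = P" "HB_Phi \<tau> (- of_real w) = Q"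
    using HB_Phi_of_real(2)[of w] HB_Phi_of_real(2)[of "- w"] assms \<open>w > 0\<close> by (auto simp: P_def Q_def)
  have "z \<noteq> 0" using \<open>y > 0\<close> by (simp add: z_def)
  have zz: "(\<i> * pi / 2) * z = of_real (- (pi * y / 2))"
    by (simp add: z_def algebra_simps)
  note zz_simps = diff_conv_add_uminus mult_minus_right zz of_real_minus[symmetric] minus_minus exp_add exp_of_real
  have 1: "HB_Phi \<tau> z * x = (\<alpha> * e2 * Q + \<beta> * e1 * P) / (2 * s * z)"
  proof -
    have "exp (- (\<i> * pi / 4) + (\<i> * pi / 2) * z) = \<alpha> * e2"
      by (simp only: zz_simps \<alpha>_def e2_def)
    moreover have "exp (\<i> * pi / 4 - (\<i> * pi / 2) * z) = \<beta> * e1"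
      by (simp only: zz_simps \<beta>_def e1_def)
    ultimately show ?thesis
      using inversion \<open>z \<noteq> 0\<close> by (simp add: HB_functional_equation_def x_def s_def T PQ)
  qed
  have 2: "HB_Phi \<tau> (- z) * x' = (\<alpha> * e1 * P + \<beta> * e2 * Q) / (2 * s * (- z))"
  proof -
    have "exp (- (\<i> * pi / 4) + (\<i> * pi / 2) * (- z)) = \<alpha> * e1"
      by (simp only: zz_simps \<alpha>_def e1_def)
    moreover have "exp (\<i> * pi / 4 - (\<i> * pi / 2) * (- z)) = \<beta> * e2"
      by (simp only: zz_simps \<beta>_def e2_def)
    moreover have "- z \<noteq> 0" using \<open>z \<noteq> 0\<close> by simp
    ultimately show ?thesis
      using inversion unfolding HB_functional_equation_def x'_def s_def
      by (metis T(2) PQ)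
  qed
  \<comment> \<open>The exponent 1 / (4 C z) is odd in z, so these factors cancel in the
    product.\<close>
  have xx: "x * x' = 1"
    unfolding x_def x'_def by (simp flip: exp_add)
  have half: "exp (\<i> * complex_of_real pi / 2) = \<i>"
    using cis_pi_half by (simp add: cis_conv_exp)
  have ab: "\<alpha> * \<beta> = 1" "\<alpha> * \<alpha> = - \<i>" "\<beta> * \<beta> = \<i>"
    by (auto simp: \<alpha>_def \<beta>_def simp flip: exp_add)
       (auto simp: exp_minus half)
  have ss: "s * s = of_real (pi * C)"
    using C_pos by (simp add: s_def flip: of_real_mult)
  have zsq: "z * z = - of_real (y\<^sup>2)"
    by (simp add: z_def power2_eq_square algebra_simps)
  have "of_real (exp (log_phi (y\<^sup>2))) = HB_Phi \<tau> z * x * (HB_Phi \<tau> (- z) * x')"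
    using HB_Phi_imaginary[OF \<open>y > 0\<close>] xx by (simp add: z_def mult_ac)
  also have "\<dots> = ((\<alpha> * e2 * Q + \<beta> * e1 * P) * (\<alpha> * e1 * P + \<beta> * e2 * Q)) / (4 * (s * s) * - (z * z))"
    unfolding 1 2 by (simp add: mult_ac)
  also have "(\<alpha> * e2 * Q + \<beta> * e1 * P) * (\<alpha> * e1 * P + \<beta> * e2 * Q) =
      (\<alpha> * \<alpha> + \<beta> * \<beta>) * (e1 * e2) * (P * Q) + (\<alpha> * \<beta>) * ((e1 * P)\<^sup>2 + (e2 * Q)\<^sup>2)"
    by (simp add: algebra_simps power2_eq_square)
  also have "\<dots> = (e1 * P)\<^sup>2 + (e2 * Q)\<^sup>2"
    by (simp add: ab)
  finally have "complex_of_real (4 * pi * C * y\<^sup>2 * exp (log_phi (y\<^sup>2))) = (e1 * P)\<^sup>2 + (e2 * Q)\<^sup>2"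
    unfolding ss zsq using C_pos \<open>y > 0\<close> by (simp add: field_simps)
  also have "\<dots> = of_real (exp (2 * log_Phi w + pi * y) + exp (2 * log_Phi (- w) - pi * y))"
    unfolding e1_def e2_def P_def Q_def of_real_mult[symmetric] of_real_power[symmetric] of_real_add[symmetric]
      exp_add[symmetric] exp_double[symmetric]
    by (simp add: algebra_simps)
  finally show ?thesis by (simp only: of_real_eq_iff)
qed

text \<open>The coefficient of t^(-j/2) in 2 ln \<Phi>(w) with w = 1 / (2 pi C sqrt t).\<close>

definition inv_coeff :: "nat \<Rightarrow> real" where
  "inv_coeff j = 2 * log_coeff j / (2 * pi * C) ^ j"

text \<open>The second argument of \<open>max\<close> ensures w = 1 / (2 pi C sqrt t) <= 1/2 for
  \<open>t \<ge> cutoff\<close>, the range of \<open>log_Phi_sums\<close>; the first keeps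
  \<open>ln t\<close> nonnegative there.\<close>

definition cutoff :: real where
  "cutoff = max 1 ((1 / (pi * C))\<^sup>2)"

lemma cutoff_ge_1: "cutoff \<ge> 1"
  by (simp add: cutoff_def)

lemma cutoff_w:
  assumes "t \<ge> cutoff"
  shows "0 < 1 / (2 * pi * C * sqrt t)" "1 / (2 * pi * C * sqrt t) \<le> 1 / 2"
proof -
  have "t > 0" using assms cutoff_ge_1 by simp
  have "1 / (pi * C) \<le> sqrt t"
    using assms by (intro real_le_rsqrt) (simp add: cutoff_def)
  thus "1 / (2 * pi * C * sqrt t) \<le> 1 / 2" "0 < 1 / (2 * pi * C * sqrt t)"
    using C_pos \<open>t > 0\<close> by (auto simp: field_simps)
qed

lemma inv_coeff_sums:
  assumes "t \<ge> cutoff"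
  shows "(\<lambda>j. inv_coeff j * (1 / sqrt t) ^ j) sums (2 * log_Phi (1 / (2 * pi * C * sqrt t)))"
proof -
  have "(\<lambda>j. 2 * (log_coeff j * (1 / (2 * pi * C * sqrt t)) ^ j)) sums (2 * log_Phi (1 / (2 * pi * C * sqrt t)))"
    using cutoff_w[OF assms] by (intro sums_mult log_Phi_sums) simp
  thus ?thesis
    by (simp add: inv_coeff_def power_mult_distrib power_divide field_simps)
qed

definition remainder :: "real \<Rightarrow> real" where
  "remainder t = log_phi t - (pi * sqrt t - ln (4 * pi * C) - ln t + (\<Sum>j. inv_coeff j * (1 / sqrt t) ^ j))"

lemma remainder_measurable [measurable]: "remainder \<in> borel_measurable borel"
  unfolding remainder_def by measurable

text \<open>Pulling the growing exponential out of the inversion identity leaves exactly ln (1 + exp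
  (2 b - 2 a - 2 pi sqrt t)) with a = ln \<Phi>(w) and b = ln \<Phi>(-w). Both are at most 2 D in
  absolute value for w <= 1/2, whence the constant exp (8 D).\<close>

lemma remainder_bound:
  obtains K where "\<And>t. t \<ge> cutoff \<Longrightarrow> \<bar>remainder t\<bar> \<le> K * exp (- (2 * pi * sqrt t))"
proof -
  obtain D where D: "\<And>j. \<bar>log_coeff j\<bar> \<le> D"
    using log_coeff_bounded by blast
  have log_Phi_le: "\<bar>log_Phi w\<bar> \<le> 2 * D" if "\<bar>w\<bar> \<le> 1 / 2" for w
  proof -
    have s: "(\<lambda>j. D * (1 / 2) ^ j) sums (D * 2)"
      using geometric_sums[of "1 / 2 :: real"] by (intro sums_mult) simp
    have "norm (\<Sum>j. log_coeff j * w ^ j) \<le> (\<Sum>j. D * (1 / 2) ^ j)"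
      using D that s
      by (intro norm_suminf_le) (auto simp: abs_mult power_abs sums_iff intro!: mult_mono power_mono order_trans[OF abs_ge_zero D])
    thus ?thesis using log_Phi_sums[OF that] s by (simp add: sums_iff)
  qed
  have "\<bar>remainder t\<bar> \<le> exp (8 * D) * exp (- (2 * pi * sqrt t))" if "t \<ge> cutoff" for t
  proof -
    define w where "w = 1 / (2 * pi * C * sqrt t)"
    define a b where "a = log_Phi w" and "b = log_Phi (- w)"
    have w: "0 < w" "w \<le> 1 / 2"
      using cutoff_w[OF that] by (auto simp: w_def)
    have "t > 0" using that cutoff_ge_1 by simp
    have "4 * pi * C * t * exp (log_phi t) = exp (2 * a + pi * sqrt t) + exp (2 * b - pi * sqrt t)"
      using exp_log_phi_inversion[OF _ w_def] w(2) \<open>t > 0\<close> by (simp add: a_def b_def)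
    also have "\<dots> = exp (2 * a + pi * sqrt t) * (1 + exp (2 * b - 2 * a - 2 * pi * sqrt t))"
      by (simp add: ring_distribs flip: exp_add)
    finally have "ln (4 * pi * C * t * exp (log_phi t)) =
        ln (exp (2 * a + pi * sqrt t) * (1 + exp (2 * b - 2 * a - 2 * pi * sqrt t)))"
      by simp
    moreover have "ln (4 * pi * C * t * exp (log_phi t)) = ln (4 * pi * C) + ln t + log_phi t"
      using C_pos \<open>t > 0\<close> by (simp add: ln_mult)
    moreover have "ln (exp (2 * a + pi * sqrt t) * (1 + exp (2 * b - 2 * a - 2 * pi * sqrt t))) =
        2 * a + pi * sqrt t + ln (1 + exp (2 * b - 2 * a - 2 * pi * sqrt t))"
      using add_pos_pos[OF zero_less_one exp_gt_zero[of "2 * b - 2 * a - 2 * pi * sqrt t"]]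
      by (subst ln_mult) auto
    ultimately have "remainder t = ln (1 + exp (2 * b - 2 * a - 2 * pi * sqrt t))"
      using inv_coeff_sums[OF that] by (simp add: remainder_def sums_iff a_def w_def)
    moreover have "0 \<le> ln (1 + exp (2 * b - 2 * a - 2 * pi * sqrt t))"
      by (intro ln_ge_zero) simp
    moreover have "ln (1 + exp (2 * b - 2 * a - 2 * pi * sqrt t)) \<le> exp (2 * b - 2 * a - 2 * pi * sqrt t)"
      by (intro ln_add_one_self_le_self) simp
    moreover have "exp (2 * b - 2 * a - 2 * pi * sqrt t) \<le> exp (8 * D + - (2 * pi * sqrt t))"
      using log_Phi_le[of w] log_Phi_le[of "- w"] w by (simp add: a_def b_def)
    ultimately have "\<bar>remainder t\<bar> \<le> exp (8 * D + - (2 * pi * sqrt t))" by linarith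
    thus ?thesis by (simp only: exp_add)
  qed
  thus ?thesis by (rule that)
qed

end

section \<open>The continuation of the Dirichlet series\<close>

context linear_growth_zeros begin

lemma tau_powr_le:
  assumes "x \<ge> 0"
  shows "\<tau> (Suc n) powr (- x) \<le> (real n + 1) powr (- x)"
  using assms tau_ge[of n] by (intro powr_mono2') auto

lemma summable_tau_powr:
  assumes "x > 1"
  shows "summable (\<lambda>n. \<tau> (Suc n) powr (- x))"
proof -
  have "summable (\<lambda>n. real n powr (- x))"
    using assms by (simp add: summable_real_powr_iff)
  hence "summable (\<lambda>n. real (Suc n) powr (- x))"
    by (subst summable_Suc_iff)
  hence "summable (\<lambda>n. (real n + 1) powr (- x))"
    by (simp add: add.commute)
  thus ?thesis
    by (rule summable_comparison_test'[where N = 0]) (use assms tau_powr_le in auto)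
qed

lemma norm_tau_powr: "norm (complex_of_real (\<tau> (Suc n)) powr (- s)) = \<tau> (Suc n) powr (- Re s)"
  using tau_pos[of n] by (subst norm_powr_real_powr) auto

lemma Dirichlet_sums:
  assumes "Re s > 1"
  shows "(\<lambda>n. complex_of_real (\<tau> (Suc n)) powr (- s)) sums (\<Sum>n. complex_of_real (\<tau> (Suc n)) powr (- s))"
proof (rule summable_sums, rule summable_norm_cancel)
  show "summable (\<lambda>n. norm (complex_of_real (\<tau> (Suc n)) powr (- s)))"
    unfolding norm_tau_powr using assms by (rule summable_tau_powr)
qed

text \<open>Each fixed \<open>x > 1\<close> supplies the majorant
  \<open>\<tau> (Suc n) powr (- x)\<close> on \<open>Re s > x\<close>; holomorphy being local, these
  smaller half-planes suffice.\<close>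

lemma Dirichlet_holomorphic:
  "(\<lambda>s. \<Sum>n. complex_of_real (\<tau> (Suc n)) powr (- s)) holomorphic_on {s. Re s > 1}"
proof -
  have hol: "(\<lambda>s. \<Sum>n. complex_of_real (\<tau> (Suc n)) powr (- s)) holomorphic_on {s. Re s > x}" if "x > 1" for x
  proof (rule holomorphic_on_suminf)
    show "open {s. Re s > x}" by (rule open_halfspace_Re_gt)
    show "(\<lambda>s. complex_of_real (\<tau> (Suc n)) powr (- s)) holomorphic_on {s. Re s > x}" for n
      using tau_pos[of n] by (intro holomorphic_intros) auto
    show "norm (complex_of_real (\<tau> (Suc n)) powr (- s)) \<le> \<tau> (Suc n) powr (- x)" if "s \<in> {s. Re s > x}" for n s
      unfolding norm_tau_powr using that tau_ge[of n] by (intro powr_mono) auto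
    show "summable (\<lambda>n. \<tau> (Suc n) powr (- x))"
      using \<open>x > 1\<close> by (rule summable_tau_powr)
  qed
  show ?thesis
  proof (rule holomorphic_onI)
    fix s assume "s \<in> {s. Re s > 1}"
    hence "(1 + Re s) / 2 > 1" "s \<in> {s'. Re s' > (1 + Re s) / 2}" by auto
    with hol[of "(1 + Re s) / 2"]
    have "(\<lambda>s. \<Sum>n. complex_of_real (\<tau> (Suc n)) powr (- s)) field_differentiable at s"
      by (intro holomorphic_on_imp_differentiable_at[OF _ open_halfspace_Re_gt])
    thus "(\<lambda>s. \<Sum>n. complex_of_real (\<tau> (Suc n)) powr (- s)) field_differentiable at s within {s. Re s > 1}"
      by (rule field_differentiable_at_within)
  qed
qed

lemma Dirichlet_of_real:
  assumes "x > 1"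
  shows "(\<Sum>n. complex_of_real (\<tau> (Suc n)) powr (- of_real x)) = of_real (\<Sum>n. \<tau> (Suc n) powr (- x))"
proof -
  have "complex_of_real (\<tau> (Suc n)) powr (- of_real x) = of_real (\<tau> (Suc n) powr (- x))" for n
    using tau_pos[of n] powr_of_real[of "\<tau> (Suc n)" "- x"] by simp
  thus ?thesis
    by (simp only: suminf_of_real[OF summable_tau_powr[OF assms]])
qed

text \<open>Each logarithm is nonnegative, so the sum may be integrated term by term. A single term
  is integrable for 0 < b < 1, and its scale 1 / \<tau>_n^2 comes out as \<tau>_n^(-2b), summable
  because 2b > 1.\<close>

lemma has_bochner_integral_log_phi:
  assumes "1 / 2 < b" "b < 1"
  shows "has_bochner_integral lborel (\<lambda>t. indicator {0<..} t * (log_phi t * exp (- (b + 1) * ln t)))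
    (pi / (b * sin (pi * b)) * (\<Sum>n. \<tau> (Suc n) powr (- (2 * b))))"
proof (rule nn_integral_imp_has_bochner_integral)
  have sin_pos: "sin (pi * b) > 0"
    using assms by (intro sin_gt_zero) auto
  have nonneg: "0 \<le> pi / (b * sin (pi * b))"
    using assms sin_pos by simp
  have summ: "summable (\<lambda>n. \<tau> (Suc n) powr (- (2 * b)))"
    using assms by (intro summable_tau_powr) auto
  show "0 \<le> pi / (b * sin (pi * b)) * (\<Sum>n. \<tau> (Suc n) powr (- (2 * b)))"
    by (intro mult_nonneg_nonneg nonneg suminf_nonneg summ) auto
  show "0 \<le> indicator {0<..} t * (log_phi t * exp (- (b + 1) * ln t))" for t
    using log_phi_nonneg[of t] by (auto simp: indicator_def)
  let ?f = "\<lambda>n t. indicator {0<..} t * (ln (1 + 1 / \<tau> (Suc n) ^ 2 * t) * t powr (- b - 1))"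
  have "(\<integral>\<^sup>+ t. ennreal (indicator {0<..} t * (log_phi t * exp (- (b + 1) * ln t))) \<partial>lborel) =
    (\<integral>\<^sup>+ t. (\<Sum>n. ennreal (?f n t)) \<partial>lborel)"
  proof (rule nn_integral_cong)
    fix t :: real
    show "ennreal (indicator {0<..} t * (log_phi t * exp (- (b + 1) * ln t))) = (\<Sum>n. ennreal (?f n t))"
    proof (cases "t > 0")
      case True
      have "(\<Sum>n. ennreal (?f n t)) = ennreal (\<Sum>n. ?f n t)"
      proof (rule suminf_ennreal2)
        show "0 \<le> ?f n t" for n
          using True log_phi_term_bounds(1)[of t n] by simp
        show "summable (\<lambda>n. ?f n t)"
          using True by (intro summable_mult summable_mult2 summable_log_phi) auto
      qed
      also have "(\<Sum>n. ?f n t) = log_phi t * t powr (- b - 1)"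
        using True unfolding log_phi_def
        by (simp add: suminf_mult2[OF summable_log_phi[OF less_imp_le]] del: times_divide_eq_left)
      finally show ?thesis
        using True by (simp add: powr_def)
    qed auto
  qed
  also have "\<dots> = (\<Sum>n. \<integral>\<^sup>+ t. ennreal (?f n t) \<partial>lborel)"
    by (rule nn_integral_suminf) measurable
  also have "\<dots> = (\<Sum>n. ennreal (pi / (b * sin (pi * b)) * \<tau> (Suc n) powr (- (2 * b))))"
  proof (rule suminf_cong)
    fix n
    have "(1 / \<tau> (Suc n) ^ 2) powr b = \<tau> (Suc n) powr (- (2 * b))"
      using tau_pos[of n] by (simp add: powr_def ln_div ln_realpow)
    thus "(\<integral>\<^sup>+ t. ennreal (?f n t) \<partial>lborel) = ennreal (pi / (b * sin (pi * b)) * \<tau> (Suc n) powr (- (2 * b)))"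
      using assms tau_pos[of n]
      by (subst nn_integral_ln_one_plus_powr) (auto simp: mult.commute)
  qed
  also have "\<dots> = ennreal (\<Sum>n. pi / (b * sin (pi * b)) * \<tau> (Suc n) powr (- (2 * b)))"
    by (intro suminf_ennreal2 summable_mult summ mult_nonneg_nonneg nonneg) auto
  also have "(\<Sum>n. pi / (b * sin (pi * b)) * \<tau> (Suc n) powr (- (2 * b))) =
      pi / (b * sin (pi * b)) * (\<Sum>n. \<tau> (Suc n) powr (- (2 * b)))"
    by (rule suminf_mult[OF summ])
  finally show "(\<integral>\<^sup>+ t. ennreal (indicator {0<..} t * (log_phi t * exp (- (b + 1) * ln t))) \<partial>lborel) =
    ennreal (pi / (b * sin (pi * b)) * (\<Sum>n. \<tau> (Suc n) powr (- (2 * b))))" .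
qed measurable

end

section \<open>Splitting the Mellin integral at the cutoff\<close>

context inversion_zeros begin

text \<open>Integrating t^(-j/2) from the cutoff Y produces Y^(-b - j/2); the part Y^(-j/2) is
  absorbed here, leaving the common factor Y^(-b). By the choice of the cutoff these numbers decay
  at least like 2^(-j).\<close>

definition pole_coeff :: "nat \<Rightarrow> real" where
  "pole_coeff j = inv_coeff j * (1 / sqrt cutoff) ^ j"

lemma summable_pole_coeff: "summable (\<lambda>j. \<bar>pole_coeff j\<bar>)"
proof -
  obtain D where D: "\<And>j. \<bar>log_coeff j\<bar> \<le> D"
    using log_coeff_bounded by blast
  show ?thesis
  proof (rule summable_comparison_test'[where N = 0])
    show "summable (\<lambda>j. 2 * D * (1 / 2) ^ j)"
      by (intro summable_mult summable_geometric) auto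
    fix j
    have "\<bar>pole_coeff j\<bar> = 2 * \<bar>log_coeff j\<bar> * (1 / (2 * pi * C * sqrt cutoff)) ^ j"
      using C_pos cutoff_ge_1
      by (simp add: pole_coeff_def inv_coeff_def abs_mult power_abs power_mult_distrib power_divide)
    also have "\<dots> \<le> 2 * D * (1 / 2) ^ j"
      using D cutoff_w[of cutoff] order_trans[OF abs_ge_zero D[of 0]]
      by (intro mult_mono power_mono) auto
    finally show "norm \<bar>pole_coeff j\<bar> \<le> 2 * D * (1 / 2) ^ j" by simp
  qed
qed

text \<open>Each power t^(-j/2) contributes the simple fraction 1 / (b + j/2). Termwise integration
  is allowed since the integrals of the absolute values are dominated by a multiple of
  \<open>\<bar>pole_coeff j\<bar>\<close>.\<close>

lemma has_bochner_integral_inv_series: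
  assumes "b > 0"
  shows "has_bochner_integral lborel
    (\<lambda>t. indicator {cutoff..} t * ((\<Sum>j. inv_coeff j * (1 / sqrt t) ^ j) * exp (- (b + 1) * ln t)))
    (exp (- b * ln cutoff) * (\<Sum>j. pole_coeff j / (b + real j / 2)))"
proof -
  have Y: "cutoff > 0" using cutoff_ge_1 by simp
  have pow: "(1 / sqrt t) ^ j * exp (a * ln t) = exp ((a - real j / 2) * ln t)" if "t > 0" for t a :: real and j
  proof -
    have "exp (ln t / 2) = sqrt t"
      using that exp_ln[of "sqrt t"] by (simp add: ln_sqrt)
    hence "1 / sqrt t = exp (- (ln t / 2))"
      by (simp add: exp_minus inverse_eq_divide)
    hence "(1 / sqrt t) ^ j = exp (real j * - (ln t / 2))"
      by (simp only: exp_of_nat_mult)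
    hence "(1 / sqrt t) ^ j * exp (a * ln t) = exp (real j * - (ln t / 2) + a * ln t)"
      by (simp only: exp_add)
    also have "real j * - (ln t / 2) + a * ln t = (a - real j / 2) * ln t"
      by (simp add: algebra_simps)
    finally show ?thesis .
  qed
  define g where "g = (\<lambda>j t. inv_coeff j * (indicator {cutoff..} t * exp (- ((b + real j / 2) + 1) * ln t)))"
  define v where "v = (\<lambda>j. exp (- (b + real j / 2) * ln cutoff) / (b + real j / 2))"
  have g: "has_bochner_integral lborel (g j) (inv_coeff j * v j)" for j
    unfolding g_def v_def
    by (rule has_bochner_integral_mult_right, rule has_bochner_integral_exp_ln_atLeast) (use assms Y in auto)
  have abs_g: "has_bochner_integral lborel (\<lambda>t. norm (g j t)) (\<bar>inv_coeff j\<bar> * v j)" for j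
  proof -
    have "(\<lambda>t. norm (g j t)) = (\<lambda>t. \<bar>inv_coeff j\<bar> * (indicator {cutoff..} t * exp (- ((b + real j / 2) + 1) * ln t)))"
      by (auto simp: g_def abs_mult indicator_def)
    moreover have "has_bochner_integral lborel \<dots> (\<bar>inv_coeff j\<bar> * v j)"
      unfolding v_def
      by (rule has_bochner_integral_mult_right, rule has_bochner_integral_exp_ln_atLeast) (use assms Y in auto)
    ultimately show ?thesis by (simp only:)
  qed
  have g_eq: "g j t = indicator {cutoff..} t * exp (- (b + 1) * ln t) * (inv_coeff j * (1 / sqrt t) ^ j)" for j t
    using pow[of t j "- (b + 1)"] Y by (auto simp: g_def indicator_def algebra_simps)
  have v_eq: "inv_coeff j * v j = exp (- b * ln cutoff) * (pole_coeff j / (b + real j / 2))" for j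
    using pow[OF Y, of j "- b"] by (simp add: v_def pole_coeff_def algebra_simps)
  have v_abs: "\<bar>inv_coeff j\<bar> * v j \<le> exp (- b * ln cutoff) / b * \<bar>pole_coeff j\<bar>" for j
  proof -
    have "v j \<ge> 0" using assms by (simp add: v_def)
    hence "\<bar>inv_coeff j\<bar> * v j = \<bar>inv_coeff j * v j\<bar>" by (simp add: abs_mult)
    also have "\<dots> = exp (- b * ln cutoff) * (\<bar>pole_coeff j\<bar> / (b + real j / 2))"
      unfolding v_eq using assms by (simp add: abs_mult)
    also have "\<dots> \<le> exp (- b * ln cutoff) * (\<bar>pole_coeff j\<bar> / b)"
      using assms by (intro mult_left_mono divide_left_mono) auto
    finally show ?thesis by simp
  qed
  have int_g: "integrable lborel (g j)" for j
    using g by (auto simp: has_bochner_integral_iff)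
  have AE_summ: "AE t in lborel. summable (\<lambda>j. norm (g j t))"
  proof (rule AE_I2)
    fix t
    show "summable (\<lambda>j. norm (g j t))"
    proof (cases "t \<ge> cutoff")
      case True
      have "norm (g j t) \<le> exp (- (b + 1) * ln t) * \<bar>pole_coeff j\<bar>" for j
      proof -
        have "(1 / sqrt t) ^ j \<le> (1 / sqrt cutoff) ^ j"
          using True Y by (intro power_mono divide_left_mono) auto
        hence "\<bar>inv_coeff j\<bar> * (1 / sqrt t) ^ j \<le> \<bar>inv_coeff j\<bar> * (1 / sqrt cutoff) ^ j"
          by (intro mult_left_mono) auto
        thus ?thesis
          using True Y by (simp add: g_eq pole_coeff_def abs_mult power_abs)
      qed
      thus ?thesis
        by (intro summable_comparison_test'[OF summable_mult[OF summable_pole_coeff], where N = 0]) auto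
    qed (simp add: g_def)
  qed
  have summ_int: "summable (\<lambda>j. LINT t|lborel. norm (g j t))"
  proof -
    have "(LINT t|lborel. norm (g j t)) = \<bar>inv_coeff j\<bar> * v j" for j
      using abs_g by (auto simp: has_bochner_integral_iff)
    moreover have "summable (\<lambda>j. \<bar>inv_coeff j\<bar> * v j)"
    proof (rule summable_comparison_test'[where N = 0])
      show "summable (\<lambda>j. exp (- b * ln cutoff) / b * \<bar>pole_coeff j\<bar>)"
        by (intro summable_mult summable_pole_coeff)
      show "norm (\<bar>inv_coeff j\<bar> * v j) \<le> exp (- b * ln cutoff) / b * \<bar>pole_coeff j\<bar>" for j
        using v_abs[of j] assms by (simp add: v_def abs_mult)
    qed
    ultimately show ?thesis by simp
  qed
  have "has_bochner_integral lborel (\<lambda>t. \<Sum>j. g j t) (\<Sum>j. inv_coeff j * v j)"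
    using integrable_suminf[OF int_g AE_summ summ_int] integral_suminf[OF int_g AE_summ summ_int] g
    by (auto simp: has_bochner_integral_iff)
  also have "(\<lambda>t. \<Sum>j. g j t) =
      (\<lambda>t. indicator {cutoff..} t * ((\<Sum>j. inv_coeff j * (1 / sqrt t) ^ j) * exp (- (b + 1) * ln t)))"
  proof
    fix t
    show "(\<Sum>j. g j t) = indicator {cutoff..} t * ((\<Sum>j. inv_coeff j * (1 / sqrt t) ^ j) * exp (- (b + 1) * ln t))"
    proof (cases "t \<ge> cutoff")
      case True
      hence "summable (\<lambda>j. inv_coeff j * (1 / sqrt t) ^ j)"
        using inv_coeff_sums by (auto simp: sums_iff)
      thus ?thesis unfolding g_eq
        by (simp only: suminf_mult) (simp add: mult_ac)
    qed (simp add: g_def)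
  qed
  also have "(\<Sum>j. inv_coeff j * v j) = exp (- b * ln cutoff) * (\<Sum>j. pole_coeff j / (b + real j / 2))"
  proof -
    have "summable (\<lambda>j. pole_coeff j / (b + real j / 2))"
    proof (rule summable_comparison_test'[where N = 0])
      show "summable (\<lambda>j. \<bar>pole_coeff j\<bar> / b)"
        by (intro summable_divide summable_pole_coeff)
      show "norm (pole_coeff j / (b + real j / 2)) \<le> \<bar>pole_coeff j\<bar> / b" for j
        using assms by (auto intro!: divide_left_mono)
    qed
    thus ?thesis unfolding v_eq by (rule suminf_mult)
  qed
  finally show ?thesis .
qed

end

lemma power_div_fact_le_exp:
  fixes x :: real
  assumes "x \<ge> 0"
  shows "x ^ n / fact n \<le> exp x"
proof -
  have "(\<lambda>n. x ^ n / fact n) sums exp x"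
    using exp_converges[of x] by (simp add: field_simps)
  thus ?thesis
    using assms sum_le_suminf[of "\<lambda>n. x ^ n / fact n" "{n}"] by (simp add: sums_iff)
qed

context inversion_zeros begin

definition low_part :: "real \<Rightarrow> real" where
  "low_part t = indicator {0<..<cutoff} t * log_phi t"

definition high_part :: "real \<Rightarrow> real" where
  "high_part t = indicator {cutoff..} t * remainder t"

text \<open>The continuation of \<open>pi / (b * sin (pi * b)) * L_plus \<tau> (2 * b)\<close> to \<open>Re b < 1\<close>.\<close>
definition completed_L :: "complex \<Rightarrow> complex" where
  "completed_L b = mellin low_part b + mellin high_part b +
     exp (- b * of_real (ln cutoff)) *
       (of_real (pi * sqrt cutoff) / (b - 1 / 2) - of_real (ln (4 * pi * C) + ln cutoff) / b - 1 / b\<^sup>2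
        + (\<Sum>j. of_real (pole_coeff j) / (b + of_nat j / 2)))"

text \<open>In this range every piece of the expansion is integrable separately. Removing from the
  full integral the part below the cutoff and the explicit tails leaves the integral of
  \<open>high_part\<close>; solving for the full integral gives the closed form.\<close>

lemma completed_L_of_real:
  assumes b: "1 / 2 < b" "b < 1"
  shows "completed_L (of_real b) = of_real (pi / (b * sin (pi * b)) * (\<Sum>n. \<tau> (Suc n) powr (- (2 * b))))"
proof -
  define Y where "Y = cutoff"
  have Y: "Y \<ge> 1" "Y > 0" using cutoff_ge_1 by (auto simp: Y_def)
  define e where "e = (\<lambda>t::real. exp (- (b + 1) * ln t))"
  define I where "I = pi / (b * sin (pi * b)) * (\<Sum>n. \<tau> (Suc n) powr (- (2 * b)))"
  define f0 where "f0 = (\<lambda>t. indicator {0<..} t * (log_phi t * e t))"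
  \<comment> \<open>\<open>f1\<close> to \<open>f4\<close> are the tails of \<open>sqrt t\<close>,
    1, \<open>ln t\<close> and the series in \<open>1 / sqrt t\<close> against the kernel
    \<open>e\<close>; the square root shifts the exponent to \<open>b - 1 / 2\<close>.\<close>
  define f1 where "f1 = (\<lambda>t::real. indicator {Y..} t * exp (- ((b - 1 / 2) + 1) * ln t))"
  define f2 where "f2 = (\<lambda>t::real. indicator {Y..} t * e t)"
  define f3 where "f3 = (\<lambda>t::real. indicator {Y..} t * (ln t * e t))"
  define f4 where "f4 = (\<lambda>t. indicator {Y..} t * ((\<Sum>j. inv_coeff j * (1 / sqrt t) ^ j) * e t))"
  define v1 where "v1 = exp (- (b - 1 / 2) * ln Y) / (b - 1 / 2)"
  define v2 where "v2 = exp (- b * ln Y) / b"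
  define v3 where "v3 = exp (- b * ln Y) * (ln Y / b + 1 / b\<^sup>2)"
  define v4 where "v4 = exp (- b * ln Y) * (\<Sum>j. pole_coeff j / (b + real j / 2))"
  have h0: "has_bochner_integral lborel f0 I"
    unfolding f0_def e_def I_def by (rule has_bochner_integral_log_phi[OF b])
  have h1: "has_bochner_integral lborel f1 v1"
    unfolding f1_def v1_def using b Y by (intro has_bochner_integral_exp_ln_atLeast) auto
  have h2: "has_bochner_integral lborel f2 v2"
    unfolding f2_def v2_def e_def using b Y by (intro has_bochner_integral_exp_ln_atLeast) auto
  have h3: "has_bochner_integral lborel f3 v3"
    unfolding f3_def v3_def e_def using b Y by (intro has_bochner_integral_ln_exp_ln_atLeast) auto
  have h4: "has_bochner_integral lborel f4 v4"
    unfolding f4_def v4_def e_def Y_def using b by (intro has_bochner_integral_inv_series) auto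
  define A where "A = (LINT t|lborel. low_part t * e t)"
  have hA: "has_bochner_integral lborel (\<lambda>t. low_part t * e t) A"
  proof -
    have "integrable lborel (\<lambda>t. low_part t * e t)"
    proof (rule Bochner_Integration.integrable_bound)
      show "integrable lborel f0" using h0 by (auto simp: has_bochner_integral_iff)
    qed (auto simp: low_part_def f0_def e_def indicator_def)
    thus ?thesis by (simp add: A_def has_bochner_integral_iff)
  qed
  have "has_bochner_integral lborel
      (\<lambda>t. f0 t - low_part t * e t - pi * f1 t + ln (4 * pi * C) * f2 t + f3 t - f4 t)
      (I - A - pi * v1 + ln (4 * pi * C) * v2 + v3 - v4)"
    by (intro has_bochner_integral_add has_bochner_integral_diff has_bochner_integral_mult_right h0 hA h1 h2 h3 h4)
  also have "(\<lambda>t. f0 t - low_part t * e t - pi * f1 t + ln (4 * pi * C) * f2 t + f3 t - f4 t) =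
      (\<lambda>t. high_part t * e t)"
  proof
    fix t :: real
    consider "t \<le> 0" | "0 < t" "t < Y" | "t \<ge> Y" by linarith
    thus "f0 t - low_part t * e t - pi * f1 t + ln (4 * pi * C) * f2 t + f3 t - f4 t = high_part t * e t"
    proof cases
      case 3
      hence t: "t > 0" using Y by simp
      have "sqrt t = exp (ln t / 2)"
        using t exp_ln[of "sqrt t"] by (simp add: ln_sqrt)
      hence "sqrt t * e t = exp (ln t / 2 + - (b + 1) * ln t)"
        by (simp only: e_def exp_add)
      also have "ln t / 2 + - (b + 1) * ln t = - ((b - 1 / 2) + 1) * ln t"
        by (simp add: algebra_simps)
      finally have "f1 t = sqrt t * e t"
        using 3 by (simp add: f1_def)
      thus ?thesis
        using 3 t by (simp add: f0_def f2_def f3_def f4_def low_part_def high_part_def remainder_def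
          Y_def[symmetric] algebra_simps)
    qed (use Y in \<open>auto simp: f0_def f1_def f2_def f3_def f4_def low_part_def high_part_def Y_def[symmetric]\<close>)
  qed
  finally have E: "(LINT t|lborel. high_part t * e t) = I - A - pi * v1 + ln (4 * pi * C) * v2 + v3 - v4"
    by (simp add: has_bochner_integral_iff)
  have sum_eq: "(\<Sum>j. of_real (pole_coeff j) / (of_real b + of_nat j / 2)) =
      complex_of_real (\<Sum>j. pole_coeff j / (b + real j / 2))"
  proof -
    have "summable (\<lambda>j. complex_of_real (pole_coeff j) / (of_real b + of_nat j / 2))"
      by (rule pole_series_summable[OF summable_pole_coeff])
    moreover have eq: "complex_of_real (pole_coeff j) / (of_real b + of_nat j / 2) =
        of_real (pole_coeff j / (b + real j / 2))" for j
      by simp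
    ultimately have "summable (\<lambda>j. pole_coeff j / (b + real j / 2))"
      by (simp only: summable_of_real_iff)
    thus ?thesis unfolding eq by (rule suminf_of_real[symmetric])
  qed
  have v1_eq: "v1 = exp (- b * ln Y) * (sqrt Y / (b - 1 / 2))"
  proof -
    have "sqrt Y = exp (ln Y / 2)"
      using Y exp_ln[of "sqrt Y"] by (simp add: ln_sqrt)
    hence "exp (- b * ln Y) * sqrt Y = exp (- b * ln Y + ln Y / 2)"
      by (simp only: exp_add)
    also have "- b * ln Y + ln Y / 2 = - (b - 1 / 2) * ln Y"
      by (simp add: algebra_simps)
    finally show ?thesis by (simp add: v1_def)
  qed
  have exp_eq: "exp (- complex_of_real b * of_real (ln cutoff)) = of_real (exp (- b * ln Y))"
    by (simp add: Y_def flip: exp_of_real)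
  have "completed_L (of_real b) = of_real (A + (LINT t|lborel. high_part t * e t) +
      exp (- b * ln Y) * (pi * sqrt Y / (b - 1 / 2) - (ln (4 * pi * C) + ln Y) / b - 1 / b\<^sup>2 +
        (\<Sum>j. pole_coeff j / (b + real j / 2))))"
    unfolding completed_L_def mellin_of_real A_def e_def sum_eq exp_eq Y_def by simp
  also have "A + (LINT t|lborel. high_part t * e t) +
      exp (- b * ln Y) * (pi * sqrt Y / (b - 1 / 2) - (ln (4 * pi * C) + ln Y) / b - 1 / b\<^sup>2 +
        (\<Sum>j. pole_coeff j / (b + real j / 2))) = I"
    unfolding E v1_eq v2_def v3_def v4_def by (simp add: algebra_simps add_divide_distrib)
  finally show ?thesis by (simp only: I_def)
qed

text \<open>Near 0, \<open>log_phi t\<close> is at most a constant times \<open>t\<close>, so the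
  integrand is of size t^(-Re b), integrable exactly up to Re b < 1. The radius \<open>r\<close>,
  half the distance to that line, keeps both shifted exponents above -1.\<close>

lemma low_part_analytic:
  assumes "Re z < 1"
  shows "mellin low_part analytic_on {z}"
proof -
  define r where "r = (1 - Re z) / 2"
  have r: "r > 0" "r + Re z < 1" using assms by (auto simp: r_def field_simps)
  have [measurable]: "low_part \<in> borel_measurable borel"
    unfolding low_part_def by measurable
  define K where "K = (\<Sum>n. 1 / \<tau> (Suc n) ^ 2)"
  have int: "integrable lborel (\<lambda>t. low_part t * exp ((s - (Re z + 1)) * ln t))" if "s - Re z > - 1" for s
  proof (rule Bochner_Integration.integrable_bound)
    show "integrable lborel (\<lambda>t. K * (indicator {0<..<cutoff} t * exp ((s - Re z) * ln t)))"
      using that cutoff_ge_1 by (intro integrable_mult_right integrable_exp_ln_lessThan) auto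
    have "norm (low_part t * exp ((s - (Re z + 1)) * ln t)) \<le>
        norm (K * (indicator {0<..<cutoff} t * exp ((s - Re z) * ln t)))" for t
    proof (cases "t \<in> {0<..<cutoff}")
      case True
      have "norm (low_part t * exp ((s - (Re z + 1)) * ln t)) = log_phi t * exp ((s - (Re z + 1)) * ln t)"
        using True log_phi_nonneg[of t] by (simp add: low_part_def abs_mult)
      also have "\<dots> \<le> (K * exp (ln t)) * exp ((s - (Re z + 1)) * ln t)"
        using log_phi_le[of t] True by (intro mult_right_mono) (auto simp: K_def)
      also have "\<dots> = K * exp ((s - Re z) * ln t)"
        by (simp add: algebra_simps flip: exp_add)
      also have "\<dots> \<le> norm (K * (indicator {0<..<cutoff} t * exp ((s - Re z) * ln t)))"
        using True by (simp add: abs_mult)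
      finally show ?thesis .
    qed (simp add: low_part_def)
    thus "AE t in lborel. norm (low_part t * exp ((s - (Re z + 1)) * ln t)) \<le>
        norm (K * (indicator {0<..<cutoff} t * exp ((s - Re z) * ln t)))" by simp
  qed measurable
  have "mellin low_part holomorphic_on ball z r"
    using r by (intro mellin_holomorphic_on_ball int) auto
  hence "mellin low_part analytic_on ball z r"
    by (simp add: analytic_on_open)
  thus ?thesis by (rule analytic_on_subset) (use r in auto)
qed

text \<open>One term of the exponential series bounds exp (-2 pi sqrt t) by (2m)! t^(-m) for any m,
  so the integral converges for every exponent.\<close>

lemma high_part_analytic: "mellin high_part analytic_on {z}"
proof -
  have [measurable]: "high_part \<in> borel_measurable borel"
    unfolding high_part_def by measurable
  obtain K where K: "\<And>t. t \<ge> cutoff \<Longrightarrow> \<bar>remainder t\<bar> \<le> K * exp (- (2 * pi * sqrt t))"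
    using remainder_bound by blast
  have "K \<ge> 0"
    using order_trans[OF abs_ge_zero K[of cutoff]] by (simp add: zero_le_mult_iff)
  have int: "integrable lborel (\<lambda>t. high_part t * exp ((s - (Re z + 1)) * ln t))" for s
  proof -
    obtain m :: nat where m: "real m > s - Re z"
      using reals_Archimedean2 by blast
    define p where "p = real m - (s - Re z)"
    have "p > 0" using m by (simp add: p_def)
    show ?thesis
    proof (rule Bochner_Integration.integrable_bound)
      have "integrable lborel (\<lambda>t. indicator {cutoff..} t * exp (- (p + 1) * ln t))"
        using has_bochner_integral_exp_ln_atLeast[OF \<open>p > 0\<close>, of cutoff] cutoff_ge_1
        by (auto simp: has_bochner_integral_iff)
      thus "integrable lborel (\<lambda>t. K * fact (2 * m) * (indicator {cutoff..} t * exp (- (p + 1) * ln t)))"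
        by (rule integrable_mult_right)
      have "norm (high_part t * exp ((s - (Re z + 1)) * ln t)) \<le>
          norm (K * fact (2 * m) * (indicator {cutoff..} t * exp (- (p + 1) * ln t)))" for t
      proof (cases "t \<ge> cutoff")
        case True
        hence t: "t > 0" using cutoff_ge_1 by simp
        have pos: "0 < sqrt t ^ (2 * m)" using t by simp
        have "sqrt t ^ (2 * m) / fact (2 * m) \<le> exp (sqrt t)"
          using t power_div_fact_le_exp[of "sqrt t" "2 * m"] by simp
        also have "\<dots> \<le> exp (2 * pi * sqrt t)"
          using t pi_gt3 by (simp add: mult_le_cancel_right1)
        finally have "exp (- (2 * pi * sqrt t)) \<le> fact (2 * m) / sqrt t ^ (2 * m)"
          using pos by (simp add: exp_minus field_simps)
        also have "sqrt t ^ (2 * m) = exp (real m * ln t)"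
          using t by (simp add: power_mult exp_of_nat_mult)
        finally have le: "exp (- (2 * pi * sqrt t)) \<le> fact (2 * m) * exp (- (real m * ln t))"
          by (simp add: exp_minus divide_inverse)
        have "norm (high_part t * exp ((s - (Re z + 1)) * ln t)) = \<bar>remainder t\<bar> * exp ((s - (Re z + 1)) * ln t)"
          using True by (simp add: high_part_def abs_mult)
        also have "\<dots> \<le> (K * (fact (2 * m) * exp (- (real m * ln t)))) * exp ((s - (Re z + 1)) * ln t)"
          using order_trans[OF K[OF True] mult_left_mono[OF le \<open>K \<ge> 0\<close>]] by (intro mult_right_mono) auto
        also have "\<dots> = K * fact (2 * m) * exp (- (p + 1) * ln t)"
          by (simp add: p_def algebra_simps flip: exp_add)
        also have "\<dots> \<le> norm (K * fact (2 * m) * (indicator {cutoff..} t * exp (- (p + 1) * ln t)))"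
          using True \<open>K \<ge> 0\<close> by (simp add: abs_mult)
        finally show ?thesis .
      qed (simp add: high_part_def)
      thus "AE t in lborel. norm (high_part t * exp ((s - (Re z + 1)) * ln t)) \<le>
          norm (K * fact (2 * m) * (indicator {cutoff..} t * exp (- (p + 1) * ln t)))" by simp
    qed measurable
  qed
  have "mellin high_part holomorphic_on ball z 1"
    by (intro mellin_holomorphic_on_ball int) auto
  hence "mellin high_part analytic_on ball z 1"
    by (simp add: analytic_on_open)
  thus ?thesis by (rule analytic_on_subset) auto
qed

end

section \<open>Uniqueness of the meromorphic continuation\<close>

lemma nicely_meromorphic_remove_sings_eq:
  assumes "f nicely_meromorphic_on A" "z \<in> A"
  shows "remove_sings f z = f z"
  using assms unfolding nicely_meromorphic_on_def by auto

text \<open>The identity theorem is applied to the difference after \<open>remove_sings\<close>: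
  where poles of \<open>f\<close> and \<open>g\<close> cancel, the plain difference need not have
  its limit as value. The result is agreement near, but not at, each point; the normalised values of
  \<open>f\<close> and \<open>g\<close> close this gap.\<close>

lemma nicely_meromorphic_eqI:
  assumes f: "f nicely_meromorphic_on UNIV" and g: "g nicely_meromorphic_on UNIV"
    and "open U" "U \<noteq> {}" and eq: "\<And>z. z \<in> U \<Longrightarrow> f z = g z"
  shows "f = g"
proof
  fix z
  let ?d = "\<lambda>z. f z - g z"
  have mero: "?d meromorphic_on UNIV"
    using f g by (intro meromorphic_intros) (auto simp: nicely_meromorphic_on_def)
  hence nice: "remove_sings ?d nicely_meromorphic_on UNIV"
    by (rule remove_sings_nicely_meromorphic)
  have zero_U: "remove_sings ?d w = 0" if "w \<in> U" for w
  proof (rule remove_sings_eqI)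
    have "\<forall>\<^sub>F x in at w. x \<in> U"
      using \<open>open U\<close> that by (intro eventually_at_in_open')
    hence "\<forall>\<^sub>F x in at w. ?d x = 0"
      by eventually_elim (simp add: eq)
    thus "?d \<midarrow>w\<rightarrow> 0" by (rule tendsto_eventually)
  qed
  hence "remove_sings ?d constant_on U"
    unfolding constant_on_def by blast
  hence "remove_sings ?d constant_on UNIV"
    by (rule constant_on_extend_nicely_meromorphic_on[OF nice]) (use assms in auto)
  hence zero: "remove_sings ?d w = 0" for w
    using zero_U \<open>U \<noteq> {}\<close> unfolding constant_on_def by (metis UNIV_I ex_in_conv)
  have "\<forall>\<^sub>F w in at z. remove_sings ?d w = ?d w"
    using mero by (intro eventually_remove_sings_eq_at meromorphic_on_isolated_singularity) (rule meromorphic_on_subset, auto)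
  hence "\<forall>\<^sub>F w in at z. f w = g w"
    by eventually_elim (simp add: zero)
  hence "remove_sings f z = remove_sings g z"
    by (rule remove_sings_cong) simp
  thus "f z = g z"
    using nicely_meromorphic_remove_sings_eq[OF f] nicely_meromorphic_remove_sings_eq[OF g] by simp
qed

lemma is_L_plus_unique:
  assumes "is_L_plus \<tau> L" "is_L_plus \<tau> L'"
  shows "L = L'"
proof (rule nicely_meromorphic_eqI)
  show "L nicely_meromorphic_on UNIV" "L' nicely_meromorphic_on UNIV"
    using assms by (auto simp: is_L_plus_def)
  show "open {s. Re s > 1}" by (rule open_halfspace_Re_gt)
  have "(2 :: complex) \<in> {s. Re s > 1}" by simp
  thus "{s. Re s > 1} \<noteq> {}" by blast
  show "L s = L' s" if "s \<in> {s. Re s > 1}" for s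
    using assms that by (auto simp: is_L_plus_def intro: sums_unique2)
qed

lemma sin_cos_pi_of_nat:
  "sin (of_real pi * of_nat k) = (0 :: complex)" "cos (of_real pi * of_nat k) = (- 1 :: complex) ^ k"
proof -
  have eq: "of_real pi * of_nat k = complex_of_real (pi * real k)" by simp
  show "sin (of_real pi * of_nat k) = (0 :: complex)" "cos (of_real pi * of_nat k) = (- 1 :: complex) ^ k"
    unfolding eq sin_of_real cos_of_real by (simp_all add: sin_npi2 cos_npi2)
qed

lemma sin_pi_over_shift_tendsto:
  "(\<lambda>b. sin (of_real pi * b) / (b + of_nat k)) \<midarrow>- of_nat k\<rightarrow> of_real pi * (- 1 :: complex) ^ k"
proof -
  have sc: "sin (of_real pi * - of_nat k) = (0 :: complex)" "cos (of_real pi * - of_nat k) = (- 1 :: complex) ^ k"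
    by (simp_all add: sin_cos_pi_of_nat)
  have "((\<lambda>b. sin (of_real pi * b)) has_field_derivative of_real pi * cos (of_real pi * - of_nat k)) (at (- of_nat k :: complex))"
    by (auto intro!: derivative_eq_intros)
  thus ?thesis
    unfolding has_field_derivative_iff sc by (simp add: field_simps)
qed

section \<open>Behaviour of the continuation at nonpositive integers\<close>

context inversion_zeros begin

text \<open>Represents the Dirichlet series at \<open>2 * b\<close>. At a nonpositive integer its
  literal value is 0 because the sine vanishes, so the wanted values there are obtained as punctured
  limits.\<close>

definition continued_L :: "complex \<Rightarrow> complex" where
  "continued_L b = b * sin (of_real pi * b) / of_real pi * completed_L b"

lemma pole_coeff_0: "pole_coeff 0 = 0"
  by (simp add: pole_coeff_def inv_coeff_def log_coeff_def)

lemma completed_L_analytic: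
  assumes "Re b < 1" "b \<noteq> 1 / 2" "\<And>j. b \<noteq> - (of_nat j / 2)"
  shows "completed_L analytic_on {b}"
proof -
  have "b \<noteq> 0" using assms(3)[of 0] by simp
  have "(\<lambda>b. mellin low_part b + mellin high_part b +
     exp (- b * of_real (ln cutoff)) *
       (of_real (pi * sqrt cutoff) / (b - 1 / 2) - of_real (ln (4 * pi * C) + ln cutoff) / b - 1 / b\<^sup>2
        + (\<Sum>j. of_real (pole_coeff j) / (b + of_nat j / 2)))) analytic_on {b}"
    using assms \<open>b \<noteq> 0\<close>
    by (intro analytic_on_add analytic_on_mult analytic_on_diff low_part_analytic high_part_analytic
        pole_series_analytic summable_pole_coeff)
       (auto intro!: analytic_intros)
  thus ?thesis unfolding completed_L_def[abs_def] .
qed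

text \<open>Isolates what is singular at -k: the fraction of index 2k, because poles are half a unit
  apart, and at k = 0 also the fractions from the constant and from ln t. The entire exponential
  factor is left unexpanded.\<close>

lemma completed_L_near_pole:
  obtains h where "h analytic_on {- of_nat k}"
    "\<And>b. completed_L b = h b + exp (- b * of_real (ln cutoff)) *
      (of_real (pole_coeff (2 * k)) / (b + of_nat k) -
       (if k = 0 then of_real (ln (4 * pi * C) + ln cutoff) / b + 1 / b\<^sup>2 else 0))"
proof -
  obtain q where q: "q analytic_on {- (of_nat (2 * k) / 2 :: complex)}"
    and q_eq: "\<And>b. (\<Sum>j. of_real (pole_coeff j) / (b + of_nat j / 2)) =
      of_real (pole_coeff (2 * k)) / (b + of_nat (2 * k) / 2) + q b"
    using pole_series_remove_term[OF summable_pole_coeff] by blast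
  define h where "h = (\<lambda>b. mellin low_part b + mellin high_part b +
     exp (- b * of_real (ln cutoff)) *
       (of_real (pi * sqrt cutoff) / (b - 1 / 2) -
        (if k = 0 then 0 else of_real (ln (4 * pi * C) + ln cutoff) / b + 1 / b\<^sup>2) + q b))"
  have ne: "- (of_nat k * 2) \<noteq> (1 :: complex)"
  proof
    assume "- (of_nat k * 2) = (1 :: complex)"
    hence "Re (- (of_nat k * 2)) = Re 1" by (simp only:)
    thus False by simp
  qed
  have rat: "(\<lambda>b. if k = 0 then 0 else of_real (ln (4 * pi * C) + ln cutoff) / b + 1 / b\<^sup>2)
      analytic_on {- of_nat k :: complex}"
    by (cases "k = 0") (auto intro!: analytic_intros)
  have "h analytic_on {- of_nat k}"
    unfolding h_def using q ne rat
    by (intro analytic_on_add analytic_on_mult analytic_on_diff low_part_analytic high_part_analytic)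
       (auto intro!: analytic_intros)
  moreover have "completed_L b = h b + exp (- b * of_real (ln cutoff)) *
      (of_real (pole_coeff (2 * k)) / (b + of_nat k) -
       (if k = 0 then of_real (ln (4 * pi * C) + ln cutoff) / b + 1 / b\<^sup>2 else 0))" for b
    unfolding completed_L_def q_eq h_def by (simp add: algebra_simps)
  ultimately show ?thesis by (rule that)
qed

lemma pole_series_meromorphic:
  "(\<lambda>b. \<Sum>j. of_real (pole_coeff j) / (b + of_nat j / 2)) meromorphic_on {b :: complex}"
proof (cases "\<exists>m. b = - (of_nat m / 2)")
  case True
  then obtain m where m: "b = - (of_nat m / 2)" by blast
  obtain q where q: "q analytic_on {- (of_nat m / 2 :: complex)}"
    and q_eq: "\<And>b. (\<Sum>j. of_real (pole_coeff j) / (b + of_nat j / 2)) =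
      of_real (pole_coeff m) / (b + of_nat m / 2) + q b"
    using pole_series_remove_term[OF summable_pole_coeff] by blast
  have "q meromorphic_on {b}"
    using q unfolding m by (rule analytic_on_imp_meromorphic_on)
  thus ?thesis unfolding q_eq by (intro meromorphic_intros)
next
  case False
  thus ?thesis
    by (intro analytic_on_imp_meromorphic_on pole_series_analytic summable_pole_coeff) auto
qed

lemma continued_L_meromorphic:
  assumes "Re b < 1"
  shows "continued_L meromorphic_on {b}"
proof -
  have 1: "mellin low_part meromorphic_on {b}" "mellin high_part meromorphic_on {b}"
    by (intro analytic_on_imp_meromorphic_on low_part_analytic high_part_analytic assms)+
  have 2: "(\<lambda>b. exp (- b * of_real (ln cutoff))) meromorphic_on {b}"
    "(\<lambda>b. sin (of_real pi * b)) meromorphic_on {b}"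
    by (intro analytic_on_imp_meromorphic_on analytic_intros)+
  have "(\<lambda>b. b * sin (of_real pi * b) / of_real pi * (mellin low_part b + mellin high_part b +
     exp (- b * of_real (ln cutoff)) *
       (of_real (pi * sqrt cutoff) / (b - 1 / 2) - of_real (ln (4 * pi * C) + ln cutoff) / b - 1 / b\<^sup>2
        + (\<Sum>j. of_real (pole_coeff j) / (b + of_nat j / 2))))) meromorphic_on {b}"
    by (intro meromorphic_on_mult meromorphic_on_add meromorphic_on_diff meromorphic_on_divide
        meromorphic_on_power meromorphic_on_const meromorphic_on_id pole_series_meromorphic 1 2)
  thus ?thesis unfolding continued_L_def[abs_def] completed_L_def .
qed

text \<open>The Mellin evaluation is available on the real segment, where all integrands are
  nonnegative; the identity theorem carries it to the strip, the segment accumulating at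
  3/4.\<close>

lemma continued_L_eq_Dirichlet:
  assumes "1 / 2 < Re b" "Re b < 1"
  shows "continued_L b = (\<Sum>n. complex_of_real (\<tau> (Suc n)) powr (- (2 * b)))"
proof -
  define S where "S = {b. Re b > 1 / 2} \<inter> {b. Re b < 1}"
  define U where "U = complex_of_real ` {1 / 2<..<1}"
  have "continued_L b - (\<Sum>n. complex_of_real (\<tau> (Suc n)) powr (- (2 * b))) = 0"
  proof (rule analytic_continuation[where f = "\<lambda>b. continued_L b - (\<Sum>n. complex_of_real (\<tau> (Suc n)) powr (- (2 * b)))"
        and S = S and U = U and \<xi> = "of_real (3 / 4)"])
    show "open S"
      unfolding S_def by (intro open_Int open_halfspace_Re_gt open_halfspace_Re_lt)
    show "connected S"
      unfolding S_def by (intro convex_connected convex_Int convex_halfspace_Re_gt convex_halfspace_Re_lt)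
    show "U \<subseteq> S" "of_real (3 / 4) \<in> S" "b \<in> S"
      using assms by (auto simp: U_def S_def)
    show "of_real (3 / 4) islimpt U"
      unfolding islimpt_approachable
    proof (intro allI impI)
      fix e :: real assume "e > 0"
      define x where "x = 3 / 4 + min (e / 2) (1 / 8)"
      have x: "x \<in> {1 / 2<..<1}" "x \<noteq> 3 / 4" "\<bar>x - 3 / 4\<bar> < e"
        using \<open>e > 0\<close> by (auto simp: x_def min_def)
      have "dist (complex_of_real x) (of_real (3 / 4)) < e"
        using x by (simp only: dist_of_real dist_real_def)
      moreover have "complex_of_real x \<noteq> of_real (3 / 4)"
        using x(2) by (subst of_real_eq_iff)
      ultimately show "\<exists>x'\<in>U. x' \<noteq> of_real (3 / 4) \<and> dist x' (of_real (3 / 4)) < e"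
        using x(1) unfolding U_def by blast
    qed
    show "(\<lambda>b. continued_L b - (\<Sum>n. complex_of_real (\<tau> (Suc n)) powr (- (2 * b)))) holomorphic_on S"
    proof (rule holomorphic_on_diff)
      have "completed_L analytic_on {z}" if "z \<in> S" for z
      proof (rule completed_L_analytic)
        show "z \<noteq> - (of_nat j / 2)" for j
        proof
          assume "z = - (of_nat j / 2)"
          hence "Re z \<le> 0" by simp
          thus False using that by (simp add: S_def)
        qed
        show "z \<noteq> 1 / 2"
        proof
          assume "z = 1 / 2"
          hence "Re z = Re (1 / 2)" by (simp only:)
          thus False using that by (simp add: S_def)
        qed
      qed (use that in \<open>auto simp: S_def\<close>)
      hence "completed_L analytic_on S"
        by (subst analytic_on_analytic_at) blast
      hence "completed_L holomorphic_on S"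
        by (rule analytic_imp_holomorphic)
      thus "continued_L holomorphic_on S"
        unfolding continued_L_def by (intro holomorphic_intros) auto
      have "(\<lambda>s. \<Sum>n. complex_of_real (\<tau> (Suc n)) powr (- s)) \<circ> (\<lambda>b. 2 * b) holomorphic_on S"
        by (rule holomorphic_on_compose_gen[OF _ Dirichlet_holomorphic])
           (auto simp: S_def intro!: holomorphic_intros)
      thus "(\<lambda>b. \<Sum>n. complex_of_real (\<tau> (Suc n)) powr (- (2 * b))) holomorphic_on S"
        by (simp add: o_def)
    qed
    fix z assume "z \<in> U"
    then obtain x where z: "z = of_real x" and x: "1 / 2 < x" "x < 1"
      by (auto simp: U_def)
    have sin_pos: "sin (pi * x) > 0"
      using x by (intro sin_gt_zero) auto
    have "sin (of_real pi * of_real x) = complex_of_real (sin (pi * x))"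
      by (simp only: of_real_mult[symmetric] sin_of_real)
    hence "continued_L z = of_real (x * sin (pi * x) / pi * (pi / (x * sin (pi * x)) * (\<Sum>n. \<tau> (Suc n) powr (- (2 * x)))))"
      unfolding continued_L_def z completed_L_of_real[OF x] by (simp only: of_real_mult of_real_divide)
    also have "x * sin (pi * x) / pi * (pi / (x * sin (pi * x)) * (\<Sum>n. \<tau> (Suc n) powr (- (2 * x)))) =
        (\<Sum>n. \<tau> (Suc n) powr (- (2 * x)))"
      using x sin_pos by simp
    also have "complex_of_real \<dots> = (\<Sum>n. complex_of_real (\<tau> (Suc n)) powr (- of_real (2 * x)))"
      using x by (intro Dirichlet_of_real[symmetric]) simp
    finally show "continued_L z - (\<Sum>n. complex_of_real (\<tau> (Suc n)) powr (- (2 * z))) = 0"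
      by (simp add: z)
  qed
  thus ?thesis by simp
qed

definition even_sum :: "nat \<Rightarrow> real" where
  "even_sum k = (\<Sum>n. 1 / \<tau> (Suc n) ^ (2 * k))"

text \<open>The simple pole meets the zero of the sine, leaving the residue times (-1)^k and the
  outer factor b = -k. That factor cancels the -1/(2k) in \<open>log_coeff (2 * k)\<close> and the 2
  in \<open>inv_coeff\<close>.\<close>

lemma continued_L_tendsto_nonzero:
  assumes "k \<ge> 1"
  shows "continued_L \<midarrow>- of_nat k\<rightarrow> of_real ((- 1) ^ k * even_sum k / (2 * pi * C) ^ (2 * k))"
proof -
  obtain h where h: "h analytic_on {- of_nat k}"
    and h_eq: "\<And>b. completed_L b = h b + exp (- b * of_real (ln cutoff)) *
      (of_real (pole_coeff (2 * k)) / (b + of_nat k) -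
       (if k = 0 then of_real (ln (4 * pi * C) + ln cutoff) / b + 1 / b\<^sup>2 else 0))"
    using completed_L_near_pole by blast
  define b0 :: complex where "b0 = - of_nat k"
  have "isCont h b0"
    using h unfolding b0_def by (rule analytic_at_imp_isCont)
  hence h_lim: "h \<midarrow>b0\<rightarrow> h b0" by (simp add: isCont_def)
  have sin0: "sin (of_real pi * b0) = 0"
    by (simp add: b0_def sin_cos_pi_of_nat)
  have "(\<lambda>b. b * sin (of_real pi * b) / of_real pi * h b +
      exp (- b * of_real (ln cutoff)) * of_real (pole_coeff (2 * k)) * b / of_real pi *
        (sin (of_real pi * b) / (b + of_nat k))) \<midarrow>b0\<rightarrow>
      b0 * sin (of_real pi * b0) / of_real pi * h b0 +
      exp (- b0 * of_real (ln cutoff)) * of_real (pole_coeff (2 * k)) * b0 / of_real pi *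
        (of_real pi * (- 1) ^ k)"
    using sin_pi_over_shift_tendsto[of k] unfolding b0_def[symmetric]
    by (intro tendsto_intros h_lim) auto
  also have "(\<lambda>b. b * sin (of_real pi * b) / of_real pi * h b +
      exp (- b * of_real (ln cutoff)) * of_real (pole_coeff (2 * k)) * b / of_real pi *
        (sin (of_real pi * b) / (b + of_nat k))) = continued_L"
    using assms by (auto simp: continued_L_def h_eq fun_eq_iff algebra_simps)
  also have "b0 * sin (of_real pi * b0) / of_real pi * h b0 +
      exp (- b0 * of_real (ln cutoff)) * of_real (pole_coeff (2 * k)) * b0 / of_real pi *
        (of_real pi * (- 1) ^ k) = exp (- b0 * of_real (ln cutoff)) * of_real (pole_coeff (2 * k)) * b0 * (- 1) ^ k"
    unfolding sin0 by simp
  also have "\<dots> = of_real (- (cutoff ^ k * pole_coeff (2 * k) * real k * (- 1) ^ k))"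
  proof -
    have "exp (- b0 * of_real (ln cutoff)) = of_real (exp (real k * ln cutoff))"
      by (simp add: b0_def flip: exp_of_real)
    also have "exp (real k * ln cutoff) = cutoff ^ k"
      using cutoff_ge_1 by (simp add: exp_of_nat_mult)
    finally show ?thesis by (simp add: b0_def)
  qed
  \<comment> \<open>The dependence on the arbitrary splitting point drops out here.\<close>
  also have "cutoff ^ k * pole_coeff (2 * k) = inv_coeff (2 * k)"
    using cutoff_ge_1 by (simp add: pole_coeff_def power_divide power_mult)
  also have "- (inv_coeff (2 * k) * real k * (- 1) ^ k) = (- 1) ^ k * even_sum k / (2 * pi * C) ^ (2 * k)"
    using assms by (simp add: inv_coeff_def log_coeff_even even_sum_def)
  finally show ?thesis unfolding b0_def .
qed

text \<open>Since b sin (pi b) / pi behaves like b^2, only the double pole -1 / b^2 survives; it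
  stems from -ln t, that is, from the factor y^2 in the inversion identity.\<close>

lemma continued_L_tendsto_zero: "continued_L \<midarrow>0\<rightarrow> - 1"
proof -
  obtain h where h: "h analytic_on {- of_nat 0}"
    and h_eq: "\<And>b. completed_L b = h b + exp (- b * of_real (ln cutoff)) *
      (of_real (pole_coeff (2 * 0)) / (b + of_nat 0) -
       (if 0 = (0::nat) then of_real (ln (4 * pi * C) + ln cutoff) / b + 1 / b\<^sup>2 else 0))"
    using completed_L_near_pole[of 0] by blast
  define c where "c = complex_of_real (ln (4 * pi * C) + ln cutoff)"
  have "isCont h 0"
    using h by (intro analytic_at_imp_isCont) simp
  hence h_lim: "h \<midarrow>0\<rightarrow> h 0" by (simp add: isCont_def)
  have sin_lim: "(\<lambda>b. sin (of_real pi * b) / b) \<midarrow>0\<rightarrow> complex_of_real pi"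
    using sin_pi_over_shift_tendsto[of 0] by simp
  have "(\<lambda>b. b * sin (of_real pi * b) / of_real pi * h b -
      exp (- b * of_real (ln cutoff)) / of_real pi * (c * sin (of_real pi * b) + sin (of_real pi * b) / b)) \<midarrow>0\<rightarrow>
      0 * sin (of_real pi * 0) / of_real pi * h 0 -
      exp (- 0 * of_real (ln cutoff)) / of_real pi * (c * sin (of_real pi * 0) + of_real pi)"
    by (intro tendsto_intros h_lim sin_lim) auto
  hence "(\<lambda>b. b * sin (of_real pi * b) / of_real pi * h b -
      exp (- b * of_real (ln cutoff)) / of_real pi * (c * sin (of_real pi * b) + sin (of_real pi * b) / b)) \<midarrow>0\<rightarrow> - 1"
    by simp
  moreover have "b * sin (of_real pi * b) / of_real pi * h b -
      exp (- b * of_real (ln cutoff)) / of_real pi * (c * sin (of_real pi * b) + sin (of_real pi * b) / b) =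
      continued_L b" if "b \<noteq> 0" for b
    using that by (simp add: continued_L_def h_eq pole_coeff_0 c_def field_simps power2_eq_square)
  ultimately show ?thesis
    by (subst LIM_cong[OF refl _ refl, of 0 continued_L]) auto
qed

section \<open>Gluing, and the reflection formula\<close>

text \<open>Both branches agree for 1 < Re s < 2, so the line Re s = 1 is no seam. Values at
  singular points are provisional until \<open>remove_sings\<close> normalises them.\<close>

definition glued_L :: "complex \<Rightarrow> complex" where
  "glued_L s = (if Re s > 1 then \<Sum>n. complex_of_real (\<tau> (Suc n)) powr (- s) else continued_L (s / 2))"

lemma glued_L_eq_continued_L:
  assumes "Re s < 2"
  shows "glued_L s = continued_L (s / 2)"
  using assms continued_L_eq_Dirichlet[of "s / 2"] by (auto simp: glued_L_def)

lemma eventually_Re_less: "Re s < c \<Longrightarrow> \<forall>\<^sub>F w in nhds s. Re w < c"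
  using eventually_nhds_in_open[OF open_halfspace_Re_lt[of c], of s] by simp

lemma glued_L_analytic:
  assumes "Re s > 1"
  shows "glued_L analytic_on {s}"
proof -
  have op: "open {s. Re s > 1}" by (rule open_halfspace_Re_gt)
  have "glued_L holomorphic_on {s. Re s > 1}"
    using Dirichlet_holomorphic by (rule holomorphic_transform) (simp add: glued_L_def)
  hence "glued_L analytic_on {s. Re s > 1}"
    using op by (simp add: analytic_on_open)
  thus ?thesis by (rule analytic_on_subset) (use assms in auto)
qed

lemma glued_L_meromorphic: "glued_L meromorphic_on UNIV"
proof (subst meromorphic_on_meromorphic_at, rule ballI)
  fix s :: complex
  show "glued_L meromorphic_on {s}"
  proof (cases "Re s > 1")
    case True
    thus ?thesis by (intro analytic_on_imp_meromorphic_on glued_L_analytic)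
  next
    case False
    have "(\<lambda>s. continued_L (s / 2)) meromorphic_on {s}"
      using False
      by (intro meromorphic_on_compose[OF continued_L_meromorphic[of "s / 2"]] analytic_intros) auto
    also have "?this \<longleftrightarrow> glued_L meromorphic_on {s}"
    proof (rule meromorphic_on_cong)
      have "\<forall>\<^sub>F w in nhds s. Re w < 2"
        using False by (intro eventually_Re_less) simp
      hence "\<forall>\<^sub>F w in at s. Re w < 2"
        by (simp add: eventually_at_filter eventually_mono)
      hence "\<forall>\<^sub>F w in at s. continued_L (w / 2) = glued_L w"
        by eventually_elim (simp add: glued_L_eq_continued_L)
      thus "\<And>z. z \<in> {s} \<Longrightarrow> \<forall>\<^sub>F w in at z. continued_L (w / 2) = glued_L w" by simp
    qed simp
    finally show ?thesis .
  qed
qed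

lemma glued_L_tendsto:
  assumes "continued_L \<midarrow>- of_nat k\<rightarrow> c"
  shows "glued_L \<midarrow>- of_nat (2 * k)\<rightarrow> c"
proof -
  have "filterlim (\<lambda>s. s / 2) (at (- of_nat k)) (at (- of_nat (2 * k) :: complex))"
  proof (rule filterlim_atI)
    show "(\<lambda>s. s / 2) \<midarrow>- of_nat (2 * k)\<rightarrow> - (of_nat k :: complex)"
      by (auto intro!: tendsto_eq_intros)
    show "\<forall>\<^sub>F s in at (- of_nat (2 * k)). s / 2 \<noteq> - (of_nat k :: complex)"
      by (auto simp: eventually_at_filter field_simps)
  qed
  hence "((\<lambda>s. continued_L (s / 2)) \<longlongrightarrow> c) (at (- of_nat (2 * k)))"
    by (rule filterlim_compose[OF assms])
  moreover have "\<forall>\<^sub>F s in at (- of_nat (2 * k)). continued_L (s / 2) = glued_L s"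
  proof -
    have "\<forall>\<^sub>F s in nhds (- of_nat (2 * k)). Re s < 2"
      by (intro eventually_Re_less) simp
    hence "\<forall>\<^sub>F s in at (- of_nat (2 * k)). Re s < 2"
      by (simp add: eventually_at_filter eventually_mono)
    thus ?thesis by eventually_elim (simp add: glued_L_eq_continued_L)
  qed
  ultimately show ?thesis by (rule Lim_transform_eventually)
qed

lemma is_L_plus_glued: "is_L_plus \<tau> (remove_sings glued_L)"
  unfolding is_L_plus_def
proof (intro conjI allI impI)
  show "remove_sings glued_L nicely_meromorphic_on UNIV"
    by (rule remove_sings_nicely_meromorphic[OF glued_L_meromorphic])
  fix s :: complex assume s: "Re s > 1"
  hence "remove_sings glued_L s = (\<Sum>n. complex_of_real (\<tau> (Suc n)) powr (- s))"
    by (simp add: glued_L_analytic glued_L_def)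
  thus "(\<lambda>n. complex_of_real (\<tau> (Suc n)) powr (- s)) sums remove_sings glued_L s"
    using Dirichlet_sums[OF s] by simp
qed

lemma L_plus_eq: "L_plus \<tau> = remove_sings glued_L"
  unfolding L_plus_def using is_L_plus_glued is_L_plus_unique by (intro the_equality)

text \<open>A finite punctured limit makes the singularity removable, and
  \<open>remove_sings\<close> takes that limit as its value; regularity and value come
  together.\<close>

lemma L_plus_at_nonpos_even:
  assumes "continued_L \<midarrow>- of_nat k\<rightarrow> c"
  shows "L_plus \<tau> analytic_on {- of_nat (2 * k)}" "L_plus \<tau> (- of_nat (2 * k)) = c"
proof -
  have "isolated_singularity_at glued_L (- of_nat (2 * k))"
    using glued_L_meromorphic by (intro meromorphic_on_isolated_singularity) (rule meromorphic_on_subset, auto)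
  thus "L_plus \<tau> analytic_on {- of_nat (2 * k)}"
    unfolding L_plus_eq by (rule remove_sings_analytic_at[OF _ glued_L_tendsto[OF assms]])
  show "L_plus \<tau> (- of_nat (2 * k)) = c"
    unfolding L_plus_eq by (rule remove_sings_eqI[OF glued_L_tendsto[OF assms]])
qed

lemma L_plus_analytic_nonpos_even: "L_plus \<tau> analytic_on {- of_nat (2 * k)}"
proof (cases "k = 0")
  case True
  thus ?thesis using L_plus_at_nonpos_even(1)[where k = 0 and c = "- 1"] continued_L_tendsto_zero by simp
next
  case False
  thus ?thesis by (intro L_plus_at_nonpos_even(1)[OF continued_L_tendsto_nonzero]) simp
qed

lemma L_plus_pos_even:
  assumes "k \<ge> 1"
  shows "L_plus \<tau> (of_nat (2 * k)) = of_real (even_sum k)"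
proof -
  have Re: "Re (of_nat (2 * k)) > 1" using assms by simp
  have "L_plus \<tau> (of_nat (2 * k)) = (\<Sum>n. complex_of_real (\<tau> (Suc n)) powr (- of_real (2 * real k)))"
    using is_L_plus_glued Re Dirichlet_sums[OF Re] unfolding L_plus_eq is_L_plus_def
    by (auto simp: sums_iff)
  also have "\<dots> = of_real (\<Sum>n. \<tau> (Suc n) powr (- (2 * real k)))"
    using assms by (intro Dirichlet_of_real) simp
  also have "(\<lambda>n. \<tau> (Suc n) powr (- (2 * real k))) = (\<lambda>n. 1 / \<tau> (Suc n) ^ (2 * k))"
  proof
    fix n
    show "\<tau> (Suc n) powr (- (2 * real k)) = 1 / \<tau> (Suc n) ^ (2 * k)"
      using powr_realpow[OF tau_pos[of n], of "2 * k"] by (simp add: powr_minus divide_inverse)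
  qed
  finally show ?thesis by (simp add: even_sum_def)
qed

text \<open>The sign (-1)^k from the sine is absorbed by the power of the imaginary unit in (2 pi i
  C)^(2k).\<close>

lemma L_plus_reflection_nat:
  assumes "k \<ge> 1"
  shows "L_plus \<tau> (- of_nat (2 * k)) =
    L_plus \<tau> (of_nat (2 * k)) / (2 * complex_of_real pi * \<i> * complex_of_real C) ^ (2 * k)"
proof -
  have "(2 * complex_of_real pi * \<i> * complex_of_real C) ^ (2 * k) =
      ((2 * complex_of_real pi * \<i> * complex_of_real C)\<^sup>2) ^ k"
    by (simp only: power_mult)
  also have "(2 * complex_of_real pi * \<i> * complex_of_real C)\<^sup>2 = - of_real ((2 * pi * C)\<^sup>2)"
    by (simp add: power_mult_distrib)
  also have "(- complex_of_real ((2 * pi * C)\<^sup>2)) ^ k = (- 1) ^ k * of_real ((2 * pi * C)\<^sup>2) ^ k"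
    by (rule power_minus)
  also have "\<dots> = complex_of_real ((- 1) ^ k * (2 * pi * C) ^ (2 * k))"
    by (simp add: power_mult)
  finally have pow: "(2 * complex_of_real pi * \<i> * complex_of_real C) ^ (2 * k) = \<dots>" .
  have "(- 1) ^ k * even_sum k / (2 * pi * C) ^ (2 * k) = even_sum k / ((- 1) ^ k * (2 * pi * C) ^ (2 * k))"
    by (cases "even k") auto
  thus ?thesis
    unfolding L_plus_at_nonpos_even(2)[OF continued_L_tendsto_nonzero[OF assms]] L_plus_pos_even[OF assms] pow
    by (simp only: of_real_divide[symmetric])
qed

text \<open>Negative \<open>k\<close> is the positive case solved for the value at the positive
  argument, the power being nonzero; at \<open>k = 0\<close> both sides coincide.\<close>

lemma L_plus_reflection:
  "L_plus \<tau> (of_int (- 2 * k)) =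
    L_plus \<tau> (of_int (2 * k)) / (2 * complex_of_real pi * \<i> * complex_of_real C) powi (2 * k)"
proof -
  let ?X = "2 * complex_of_real pi * \<i> * complex_of_real C"
  have "?X \<noteq> 0" using C_pos by simp
  consider "k = 0" | m where "m \<ge> 1" "k = int m" | m where "m \<ge> 1" "k = - int m"
  proof (cases k rule: int_cases3)
    case (pos n)
    thus ?thesis by (intro that(2)[of n]) auto
  next
    case (neg n)
    thus ?thesis by (intro that(3)[of n]) auto
  qed (rule that(1))
  thus ?thesis
  proof cases
    case 2
    thus ?thesis
      using L_plus_reflection_nat[of m] by (simp add: power_int_def nat_mult_distrib)
  next
    case 3
    have "?X powi (2 * k) = inverse (?X ^ (2 * m))"
    proof -
      have "2 * k = - int (2 * m)" using 3 by simp
      thus ?thesis by (simp only: power_int_minus power_int_of_nat)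
    qed
    moreover have "of_int (- 2 * k) = complex_of_nat (2 * m)" "of_int (2 * k) = - complex_of_nat (2 * m)"
      using 3 by simp_all
    moreover have "?X ^ (2 * m) \<noteq> 0"
      using \<open>?X \<noteq> 0\<close> by (rule power_not_zero)
    ultimately show ?thesis
      unfolding L_plus_reflection_nat[OF 3(1)] by (simp only: L_plus_reflection_nat[OF 3(1)]) simp
  qed simp
qed

end

theorem theorem1p2:
  fixes \<phi> :: "complex \<Rightarrow> complex" and \<tau> :: "nat \<Rightarrow> real" and r :: "nat \<Rightarrow> real" and C :: real
  assumes extremal: "HB_extremal \<phi>"
    and even: "\<forall>z. \<phi> (- z) = \<phi> z"
    and tau_pos: "0 < \<tau> 1"
    and tau_mono: "\<forall>n\<ge>1. \<tau> n < \<tau> (Suc n)"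
    and tau_lim: "filterlim \<tau> at_top sequentially"
    and zeros: "{z. \<phi> z = 0} = {z. \<exists>n\<ge>1. z = of_real (\<tau> n) \<or> z = - of_real (\<tau> n)}"
    and simple: "\<forall>z. \<phi> z = 0 \<longrightarrow> zorder \<phi> z = 1"
    and product: "\<forall>z. (\<lambda>n. 1 - z\<^sup>2 / (of_real (\<tau> (Suc n)))\<^sup>2) has_prod \<phi> z"
    and rho_nonneg: "\<forall>j. r j \<ge> 0"
    and rho_odd: "\<forall>j. even j \<longrightarrow> r j = 0"
    and rho_conv: "\<forall>z::complex. summable (\<lambda>j. of_real (r j) * z ^ j) \<longleftrightarrow> norm z \<le> 2"
    and rho_2: "(\<lambda>j. r j * 2 ^ j) sums (1/2)"
    and tau_rho: "\<forall>n\<ge>1. \<tau> n = real n + 1/2 - (\<Sum>j. r j * (1 / (real n + 1/2)) ^ j)"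
    and C_pos: "C > 0"
    and inversion: "HB_functional_equation \<tau> C"
  shows "is_L_plus \<tau> (L_plus \<tau>) \<and>
         (\<forall>k::nat. L_plus \<tau> analytic_on {- of_nat (2 * k)}) \<and>
         (\<forall>k::int. L_plus \<tau> (of_int (- 2 * k)) =
            L_plus \<tau> (of_int (2 * k))
              / (2 * complex_of_real pi * \<i> * complex_of_real C) powi (2 * k))"
proof -
  \<comment> \<open>The coefficients are nonnegative and the argument of rho lies in [0, 2], so rho
    is at most rho(2) = 1/2, the very amount by which the index was shifted.\<close>
  have ge: "\<tau> (Suc n) \<ge> real n + 1" for n
  proof -
    define x where "x = 1 / (real (Suc n) + 1 / 2)"
    have x: "0 \<le> x" "x \<le> 2" by (auto simp: x_def field_simps)
    have le: "r j * x ^ j \<le> r j * 2 ^ j" for j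
      using x rho_nonneg by (intro mult_left_mono power_mono) auto
    have "summable (\<lambda>j. r j * x ^ j)"
      using x rho_nonneg le
      by (intro summable_comparison_test'[OF sums_summable[OF rho_2], where N = 0]) (auto simp: abs_mult)
    hence "(\<Sum>j. r j * x ^ j) \<le> (\<Sum>j. r j * 2 ^ j)"
      using le sums_summable[OF rho_2] by (intro suminf_le)
    hence "(\<Sum>j. r j * x ^ j) \<le> 1 / 2"
      using rho_2 by (simp add: sums_iff)
    moreover have "\<tau> (Suc n) = real (Suc n) + 1 / 2 - (\<Sum>j. r j * x ^ j)"
      using tau_rho unfolding x_def by simp
    ultimately show ?thesis by simp
  qed
  interpret inversion_zeros \<tau> C
    using ge tau_mono C_pos inversion by unfold_locales (auto intro: less_imp_le)
  show ?thesis
    using is_L_plus_glued L_plus_analytic_nonpos_even L_plus_reflection by (auto simp only: L_plus_eq)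
qed

end
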